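(* Let $l,\alpha,k>0$. Let $\mathbf{M}\in\mathrm{wp}(4,8,\mathbb{C})$ and $\lambda\in\mathbb{C}$. Then $\lambda\in\operatorname{Spec}\mathcal{K}_{\mathbf{M}}$ if and only if $\lambda\neq0$ and $$\det\left[\mathbf{G}_{\mathbf{M}}\left\{\mathbf{X}_\lambda(l)-\mathbf{X}_\lambda(-l)\right\}+\mathbf{X}_\lambda(l)\right]=0.$$ Moreover, $\lambda\in\operatorname{Spec}\mathcal{K}_{\mathbf{Q}}$ if and only if $\lambda\neq0$ and $\det\mathbf{X}_\lambda(l)=0$.
   Context: Fix $l,\alpha,k>0$. $\mathrm{gl}(m,n,\mathbb{C})$ is the set of complex $m\times n$ matrices, $\mathrm{gl}(n,\mathbb{C})=\mathrm{gl}(n,n,\mathbb{C})$; $L^2[-l,l]$ is the Hilbert space of complex-valued square-integrable functions. $\operatorname{Spec}$ of an operator denotes its set of (complex) eigenvalues. Matrices. $\omega_j=e^{\sqrt{-1}\,\frac{\pi}{4}(2j-1)}$ ($j\in\mathbb{Z}$), $\mathbf{\Omega}=\mathrm{diag}(\omega_1,\omega_2,\omega_3,\omega_4)$, $\mathcal{E}=\mathrm{diag}(1,-1,-1,1)$, and $\mathbf{L}^2=\begin{pmatrix}0&0&1&0\\0&0&0&1\\1&0&0&0\\0&1&0&0\end{pmatrix}$. Let $\mathbf{y}(x)=(e^{\omega_1\alpha x},e^{\omega_2\alpha x},e^{\omega_3\alpha x},e^{\omega_4\alpha x})^T$ and $\mathbf{W}(x)=\left((\omega_q\alpha)^{p-1}e^{\omega_q\alpha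 x}\right)_{1\le p,q\le 4}$ (row index $p$, column index $q$), which is invertible for every $x$. Well-posedness. Write $\mathbf{M}=(\mathbf{M}^-\ \mathbf{M}^+)\in\mathrm{gl}(4,8,\mathbb{C})$ with $\mathbf{M}^\pm\in\mathrm{gl}(4,\mathbb{C})$. For $u\in C^3[-l,l]$, $\mathcal{B}[u]=(u(-l),u'(-l),u''(-l),u'''(-l),u(l),u'(l),u''(l),u'''(l))^T$. $\mathbf{M}$ is well-posed if $u=0$ is the only solution of $u^{(4)}+\alpha^4u=0$ on $[-l,l]$ with $\mathbf{M}\cdot\mathcal{B}[u]=\mathbf{0}$; $\mathrm{wp}(4,8,\mathbb{C})$ is the set of well-posed matrices. Put $\widetilde{\mathbf{M}}^-=\mathbf{M}^-\mathbf{W}(-l)$, $\widetilde{\mathbf{M}}^+=\mathbf{M}^+\mathbf{W}(l)$, $\widetilde{\mathbf{M}}=\widetilde{\mathbf{M}}^-+\widetilde{\mathbf{M}}^+$ (invertible when $\mathbf{M}$ is well-posed). For well-posed $\mathbf{M}$ let $\mathbf{G}_{\mathbf{M}}^\pm=\widetilde{\mathbf{M}}^{-1}\widetilde{\mathbf{M}}^\pm\mathbf{\Omega}\mathbf{L}^2$. Operator. The Green's function is $G_{\mathbf{M}}(x,\xi)=\frac{\alpha}{4k}\mathbf{y}(x)^T\mathbf{G}_{\mathbf{M}}^+\mathbf{y}(\xi)$ if $x\le\xi$ and $-\frac{\alpha}{4k}\mathbf{y}(x)^T\mathbf{G}_{\mathbf{M}}^-\mathbf{y}(\xi)$ if $\xi\le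 x$, and $\mathcal{K}_{\mathbf{M}}:L^2[-l,l]\to L^2[-l,l]$ is $\mathcal{K}_{\mathbf{M}}[w](x)=\int_{-l}^lG_{\mathbf{M}}(x,\xi)w(\xi)\,d\xi$. The matrix $\mathbf{Q}=\left(\begin{array}{cccc|cccc}0&\alpha^2&-\sqrt2\alpha&1&0&0&0&0\\ \sqrt2\alpha^3&-\alpha^2&0&1&0&0&0&0\\0&0&0&0&0&\alpha^2&\sqrt2\alpha&1\\0&0&0&0&-\sqrt2\alpha^3&-\alpha^2&0&1\end{array}\right)$ is well-posed. For $\mathbf{M}\in\mathrm{wp}(4,8,\mathbb{C})$, the $4\times4$ matrix $\mathbf{G}_{\mathbf{M}}$ (not to be confused with the function $G_{\mathbf{M}}$) is $\mathbf{G}_{\mathbf{M}}=(\mathbf{G}_{\mathbf{M}}^+-\mathbf{G}_{\mathbf{Q}}^+)(\mathbf{\Omega}\mathbf{L}^2)^{-1}\mathcal{E}$. $\lambda$-dependent objects. For $\lambda\in\mathbb{C}\setminus\{0,1/k\}$, $\kappa=\chi(\lambda)$ is the unique complex number with $\kappa^4=1-1/(\lambda k)$ and $0\le\operatorname{Arg}\kappa<\pi/2$. For $\lambda\ne0$: $y_{\lambda,j}(x)=\frac{x^{j-1}}{(j-1)!}$ if $\lambda=1/k$, and $y_{\lambda,j}(x)=e^{\omega_j\kappa\alpha x}$ if $\lambda\ne1/k$ ($j=1,2,3,4$); $\mathbf{W}_\lambda(x)=\left(y_{\lambda,q}^{(p-1)}(x)\right)_{1\le p,q\le4}$. For $0\ne\lambda\in\mathbb{C}$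 and $x\in\mathbb{R}$, $$\mathbf{X}_\lambda(x)=\mathrm{diag}(0,1,1,0)\mathbf{W}(-x)^{-1}\mathbf{W}_\lambda(-x)+\mathrm{diag}(1,0,0,1)\mathbf{W}(x)^{-1}\mathbf{W}_\lambda(x).$$ *)

theory Defs
  imports "HOL-Analysis.Analysis"
begin


text \<open>
  The index types \<^typ>\<open>4\<close> and \<^typ>\<open>8\<close> are arithmetic modulo 4 and 8, so the last row or
  column is the index \<open>4 = 0\<close> resp. \<open>8 = 0\<close>; \<open>vector [x\<^sub>1, \<dots>, x\<^sub>n]\<close> has entry \<open>x\<^sub>i\<close> at index
  \<open>i\<close>. The function below recovers the position in \<open>1, \<dots>, 4\<close> as a natural number.
\<close>

definition ix :: "4 \<Rightarrow> nat" where
  "ix i = (if i = 1 then 1 else if i = 2 then 2 else if i = 3 then 3 else 4)"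

definition diag :: "complex ^ 4 \<Rightarrow> complex ^ 4 ^ 4" where
  "diag v = (\<chi> i j. if i = j then v $ i else 0)"

definition omega :: "int \<Rightarrow> complex" where
  "omega j = exp (\<i> * of_real (pi / 4 * (2 * of_int j - 1)))"

definition Omega :: "complex ^ 4 ^ 4" where
  "Omega = diag (vector [omega 1, omega 2, omega 3, omega 4])"

definition Emat :: "complex ^ 4 ^ 4" where
  "Emat = diag (vector [1, -1, -1, 1])"

definition Lsq :: "complex ^ 4 ^ 4" where
  "Lsq = vector [vector [0, 0, 1, 0],
                 vector [0, 0, 0, 1],
                 vector [1, 0, 0, 0],
                 vector [0, 1, 0, 0]]"

definition yvec :: "real \<Rightarrow> real \<Rightarrow> complex ^ 4" where
  "yvec \<alpha> x = (\<chi> j. exp (omega (int (ix j)) * of_real \<alpha> * of_real x))"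

definition W :: "real \<Rightarrow> real \<Rightarrow> complex ^ 4 ^ 4" where
  "W \<alpha> x = (\<chi> p q. (omega (int (ix q)) * of_real \<alpha>) ^ (ix p - 1)
                   * exp (omega (int (ix q)) * of_real \<alpha> * of_real x))"

text \<open>Iterated derivatives relative to \<open>S\<close>: one-sided at the endpoints when \<open>S\<close> is an interval.\<close>

definition nderiv :: "real set \<Rightarrow> nat \<Rightarrow> (real \<Rightarrow> complex) \<Rightarrow> real \<Rightarrow> complex" where
  "nderiv S n u = ((\<lambda>v x. vector_derivative v (at x within S)) ^^ n) u"

definition C_on :: "nat \<Rightarrow> real set \<Rightarrow> (real \<Rightarrow> complex) set" where
  "C_on n S = {u. (\<forall>i<n. \<forall>x\<in>S. nderiv S i u differentiable (at x within S))
                  \<and> continuous_on S (nderiv S n u)}"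

definition bvals :: "real \<Rightarrow> (real \<Rightarrow> complex) \<Rightarrow> complex ^ 8" where
  "bvals l u = (let D = (\<lambda>n. nderiv {-l..l} n u) in
     vector [D 0 (-l), D 1 (-l), D 2 (-l), D 3 (-l), D 0 l, D 1 l, D 2 l, D 3 l])"

definition wp :: "real \<Rightarrow> real \<Rightarrow> (complex ^ 8 ^ 4) set" where
  "wp l \<alpha> = {M. \<forall>u \<in> C_on 4 {-l..l}.
     (\<forall>x\<in>{-l..l}. nderiv {-l..l} 4 u x + of_real (\<alpha> ^ 4) * u x = 0) \<and> M *v bvals l u = 0
     \<longrightarrow> (\<forall>x\<in>{-l..l}. u x = 0)}"

definition Mminus :: "complex ^ 8 ^ 4 \<Rightarrow> complex ^ 4 ^ 4" where
  "Mminus M = (\<chi> p q. M $ p $ of_nat (ix q))"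

definition Mplus :: "complex ^ 8 ^ 4 \<Rightarrow> complex ^ 4 ^ 4" where
  "Mplus M = (\<chi> p q. M $ p $ of_nat (4 + ix q))"

definition Mtilde_minus :: "real \<Rightarrow> real \<Rightarrow> complex ^ 8 ^ 4 \<Rightarrow> complex ^ 4 ^ 4" where
  "Mtilde_minus l \<alpha> M = Mminus M ** W \<alpha> (-l)"

definition Mtilde_plus :: "real \<Rightarrow> real \<Rightarrow> complex ^ 8 ^ 4 \<Rightarrow> complex ^ 4 ^ 4" where
  "Mtilde_plus l \<alpha> M = Mplus M ** W \<alpha> l"

definition Mtilde :: "real \<Rightarrow> real \<Rightarrow> complex ^ 8 ^ 4 \<Rightarrow> complex ^ 4 ^ 4" where
  "Mtilde l \<alpha> M = Mtilde_minus l \<alpha> M + Mtilde_plus l \<alpha> M"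

definition Gminus :: "real \<Rightarrow> real \<Rightarrow> complex ^ 8 ^ 4 \<Rightarrow> complex ^ 4 ^ 4" where
  "Gminus l \<alpha> M = matrix_inv (Mtilde l \<alpha> M) ** Mtilde_minus l \<alpha> M ** Omega ** Lsq"

definition Gplus :: "real \<Rightarrow> real \<Rightarrow> complex ^ 8 ^ 4 \<Rightarrow> complex ^ 4 ^ 4" where
  "Gplus l \<alpha> M = matrix_inv (Mtilde l \<alpha> M) ** Mtilde_plus l \<alpha> M ** Omega ** Lsq"

text \<open>For well-posed \<open>M\<close> the two branches agree at \<open>x = \<xi>\<close>.\<close>

definition Green :: "real \<Rightarrow> real \<Rightarrow> real \<Rightarrow> complex ^ 8 ^ 4 \<Rightarrow> real \<Rightarrow> real \<Rightarrow> complex" where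
  "Green l \<alpha> k M x \<xi> =
     (if x \<le> \<xi>
      then of_real (\<alpha> / (4 * k)) * scalar_product (yvec \<alpha> x) (Gplus l \<alpha> M *v yvec \<alpha> \<xi>)
      else - of_real (\<alpha> / (4 * k)) * scalar_product (yvec \<alpha> x) (Gminus l \<alpha> M *v yvec \<alpha> \<xi>))"

text \<open>
  Elements of \<open>L\<^sup>2[-l,l]\<close> are represented by functions, with equality almost everywhere.
  In \<open>Spec\<close>, \<open>T\<close> is an operator given on representatives.
\<close>

definition L2 :: "real \<Rightarrow> (real \<Rightarrow> complex) set" where
  "L2 l = {w \<in> borel_measurable (lebesgue_on {-l..l}).
             integrable (lebesgue_on {-l..l}) (\<lambda>x. (cmod (w x))\<^sup>2)}"

definition Kop :: "real \<Rightarrow> real \<Rightarrow> real \<Rightarrow> complex ^ 8 ^ 4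
    \<Rightarrow> (real \<Rightarrow> complex) \<Rightarrow> real \<Rightarrow> complex" where
  "Kop l \<alpha> k M w x = (LINT \<xi>|lebesgue_on {-l..l}. Green l \<alpha> k M x \<xi> * w \<xi>)"

definition Spec :: "real \<Rightarrow> ((real \<Rightarrow> complex) \<Rightarrow> real \<Rightarrow> complex) \<Rightarrow> complex set" where
  "Spec l T = {lam. \<exists>w\<in>L2 l. \<not> (AE x in lebesgue_on {-l..l}. w x = 0)
                     \<and> (AE x in lebesgue_on {-l..l}. T w x = lam * w x)}"

definition Q :: "real \<Rightarrow> complex ^ 8 ^ 4" where
  "Q \<alpha> = (let a = complex_of_real \<alpha>; s = complex_of_real (sqrt 2) in
     vector [vector [0, a^2, - s * a, 1,   0, 0, 0, 0],
             vector [s * a^3, - (a^2), 0, 1,   0, 0, 0, 0],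
             vector [0, 0, 0, 0,   0, a^2, s * a, 1],
             vector [0, 0, 0, 0,   - s * a^3, - (a^2), 0, 1]])"

definition Gmat :: "real \<Rightarrow> real \<Rightarrow> complex ^ 8 ^ 4 \<Rightarrow> complex ^ 4 ^ 4" where
  "Gmat l \<alpha> M = (Gplus l \<alpha> M - Gplus l \<alpha> (Q \<alpha>)) ** matrix_inv (Omega ** Lsq) ** Emat"

definition chi :: "real \<Rightarrow> complex \<Rightarrow> complex" where
  "chi k lam = (THE \<kappa>. \<kappa> ^ 4 = 1 - 1 / (lam * of_real k) \<and> 0 \<le> Arg \<kappa> \<and> Arg \<kappa> < pi / 2)"

definition ylam :: "real \<Rightarrow> real \<Rightarrow> complex \<Rightarrow> nat \<Rightarrow> real \<Rightarrow> complex" where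
  "ylam \<alpha> k lam j x =
     (if lam = 1 / of_real k then of_real x ^ (j - 1) / fact (j - 1)
      else exp (omega (int j) * chi k lam * of_real \<alpha> * of_real x))"

definition Wlam :: "real \<Rightarrow> real \<Rightarrow> complex \<Rightarrow> real \<Rightarrow> complex ^ 4 ^ 4" where
  "Wlam \<alpha> k lam x = (\<chi> p q. nderiv UNIV (ix p - 1) (ylam \<alpha> k lam (ix q)) x)"

definition X :: "real \<Rightarrow> real \<Rightarrow> complex \<Rightarrow> real \<Rightarrow> complex ^ 4 ^ 4" where
  "X \<alpha> k lam x =
     diag (vector [0, 1, 1, 0]) ** matrix_inv (W \<alpha> (-x)) ** Wlam \<alpha> k lam (-x)
   + diag (vector [1, 0, 0, 1]) ** matrix_inv (W \<alpha> x) ** Wlam \<alpha> k lam x"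

end

theory Submission
  imports Defs
begin

text \<open>
  Variation of constants gives \<open>Kop w = (W f)\<^sub>1\<close> on \<open>[-l,l]\<close> for a vector function \<open>f\<close> whose derivative is
  explicit in \<open>w\<close>. Hence \<open>u = Kop w\<close> solves \<open>u'''' + \<alpha>\<^sup>4 u = (\<alpha>\<^sup>4 / k) w\<close> with the boundary conditions
  given by \<open>M\<close>. For \<open>lam = 0\<close> this forces \<open>w = 0\<close>, by Lebesgue differentiation. For \<open>lam \<noteq> 0\<close> the
  eigenfunctions are the nonzero solutions of \<open>u'''' = \<alpha>\<^sup>4 (1 / (lam k) - 1) u\<close> with the same boundary
  conditions. Expanding \<open>u\<close> in the basis \<open>ylam\<close> turns these conditions into a homogeneous linear system
  whose matrix is \<open>Mtilde (A + P (B - A))\<close>, where \<open>A\<close> and \<open>B\<close> are \<open>W\<^sup>-\<^sup>1 Wlam\<close> at \<open>-l\<close> and \<open>l\<close>, and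
  \<open>P = Mtilde\<^sup>-\<^sup>1 Mtilde_plus\<close>. For \<open>Q\<close> one has \<open>P = diag (1, 0, 0, 1)\<close>, so the second factor is then
  \<open>X l\<close>; for general \<open>M\<close> it is \<open>Gmat (X l - X (-l)) + X l\<close>.
\<close>

section \<open>Indices modulo 4 and 8, and entries of explicit vectors\<close>

lemma ix_simps [simp]: "ix 1 = 1" "ix 2 = 2" "ix 3 = 3" "ix 4 = 4" "ix 0 = 4"
  by (simp_all add: ix_def)

lemma vector_4 [simp]:
  "(vector [a, b, c, d] :: 'a::zero ^ 4) $ 1 = a"
  "(vector [a, b, c, d] :: 'a::zero ^ 4) $ 2 = b"
  "(vector [a, b, c, d] :: 'a::zero ^ 4) $ 3 = c"
  "(vector [a, b, c, d] :: 'a::zero ^ 4) $ 4 = d"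
  unfolding vector_def by simp_all

lemma vector_8 [simp]:
  "(vector [a, b, c, d, e, f, g, h] :: 'a::zero ^ 8) $ 1 = a"
  "(vector [a, b, c, d, e, f, g, h] :: 'a::zero ^ 8) $ 2 = b"
  "(vector [a, b, c, d, e, f, g, h] :: 'a::zero ^ 8) $ 3 = c"
  "(vector [a, b, c, d, e, f, g, h] :: 'a::zero ^ 8) $ 4 = d"
  "(vector [a, b, c, d, e, f, g, h] :: 'a::zero ^ 8) $ 5 = e"
  "(vector [a, b, c, d, e, f, g, h] :: 'a::zero ^ 8) $ 6 = f"
  "(vector [a, b, c, d, e, f, g, h] :: 'a::zero ^ 8) $ 7 = g"
  "(vector [a, b, c, d, e, f, g, h] :: 'a::zero ^ 8) $ 8 = h"
  unfolding vector_def by simp_all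

lemma sum_8: "sum f (UNIV :: 8 set) = f 1 + f 2 + f 3 + f 4 + f 5 + f 6 + f 7 + f 8"
proof -
  have "{1, 2, 3, 4, 5, 6, 7, 8 :: 8} = UNIV"
    by (rule card_subset_eq) simp_all
  then have "sum f UNIV = sum f {1, 2, 3, 4, 5, 6, 7, 8 :: 8}"
    by simp
  also have "\<dots> = f 1 + f 2 + f 3 + f 4 + f 5 + f 6 + f 7 + f 8"
    by (simp add: ac_simps)
  finally show ?thesis .
qed

subsection \<open>Fourth roots of \<open>-1\<close>\<close>

text \<open>Taking the argument from the index type allows sums over \<open>UNIV\<close> and shifts
  modulo 4.\<close>

definition om :: "4 \<Rightarrow> complex" where
  "om q = omega (int (ix q))"

lemma om_explicit:
  defines "s \<equiv> complex_of_real (sqrt 2 / 2)"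
  shows "om 1 = s + \<i> * s" "om 2 = - s + \<i> * s" "om 3 = - s - \<i> * s" "om 4 = s - \<i> * s"
proof -
  have *: "exp (\<i> * of_real t) = of_real (cos t) + \<i> * of_real (sin t)" for t
    by (metis cis.simps complex_eq cis_conv_exp)
  show "om 1 = s + \<i> * s"
    by (simp add: om_def omega_def * cos_45 sin_45 s_def del: of_real_divide of_real_mult)
  have "pi / 4 * 3 = pi - pi / 4" by simp
  then have "cos (pi / 4 * 3) = - (sqrt 2 / 2)" "sin (pi / 4 * 3) = sqrt 2 / 2"
    by (simp_all only: cos_pi_minus sin_pi_minus cos_45 sin_45)
  then show "om 2 = - s + \<i> * s"
    by (simp add: om_def omega_def * s_def del: of_real_divide of_real_mult)
  have "pi / 4 * 5 = pi / 4 + pi" by simp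
  then have "cos (pi / 4 * 5) = - (sqrt 2 / 2)" "sin (pi / 4 * 5) = - (sqrt 2 / 2)"
    by (simp_all only: cos_periodic_pi sin_periodic_pi cos_45 sin_45)
  then show "om 3 = - s - \<i> * s"
    by (simp add: om_def omega_def * s_def del: of_real_divide of_real_mult)
  have "pi / 4 * 7 = - (pi / 4) + 2 * pi" by simp
  then have "cos (pi / 4 * 7) = sqrt 2 / 2" "sin (pi / 4 * 7) = - (sqrt 2 / 2)"
    by (simp_all only: cos_periodic sin_periodic cos_minus sin_minus cos_45 sin_45)
  then show "om 4 = s - \<i> * s"
    by (simp add: om_def omega_def * s_def del: of_real_divide of_real_mult)
qed

lemma sqrt2_half_sq: "complex_of_real (sqrt 2 / 2) * complex_of_real (sqrt 2 / 2) = 1 / 2"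
  unfolding of_real_mult [symmetric] by (simp add: field_simps)

lemma om_pow4: "om q ^ 4 = - 1"
proof -
  define s where "s = complex_of_real (sqrt 2 / 2)"
  have s: "s * s = 1 / 2" unfolding s_def by (rule sqrt2_half_sq)
  have i: "\<i> * \<i> = -1" by simp
  \<comment> \<open>Given the two relations for \<open>s\<close> and \<open>\<i>\<close>, these are
    identities in a polynomial ring.\<close>
  have "(s + \<i> * s) ^ 4 = -1" "(- s + \<i> * s) ^ 4 = -1"
       "(- s - \<i> * s) ^ 4 = -1" "(s - \<i> * s) ^ 4 = -1"
    using s i by algebra+
  then show ?thesis
    using exhaust_4 [of q] by (auto simp: om_explicit s_def)
qed

lemma om_nz [simp]: "om q \<noteq> 0"
  using om_pow4 [of q] by auto

lemma om_inj: "q \<noteq> r \<Longrightarrow> om q \<noteq> om r"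
proof -
  define s where "s = complex_of_real (sqrt 2 / 2)"
  have s: "s \<noteq> 0" by (simp add: s_def)
  have "om 1 \<noteq> om 2 \<and> om 1 \<noteq> om 3 \<and> om 1 \<noteq> om 4 \<and> om 2 \<noteq> om 3 \<and> om 2 \<noteq> om 4 \<and> om 3 \<noteq> om 4"
    by (simp add: om_explicit complex_eq_iff)
  then show "q \<noteq> r \<Longrightarrow> om q \<noteq> om r"
    using exhaust_4 [of q] exhaust_4 [of r] by metis
qed

text \<open>Two index steps add \<pi> to the argument. The lemma turns the exponential at index
  \<open>q + 2\<close> into the reciprocal of the one at \<open>q\<close>.\<close>

lemma om_shift: "om (q + 2) = - om q"
proof -
  have *: "(5::4) = 1" "(6::4) = 2" by simp_all
  show ?thesis
    using exhaust_4 [of q] by (auto simp: om_explicit *)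
qed

text \<open>The power sums of the roots of z^4 + 1 vanish for the exponents 1, 2, 3. This keeps the
  source term out of the first three rows in \<open>Kvec_has_vector_derivative\<close>.\<close>

lemma sum_om_pow:
  "(\<Sum>q\<in>UNIV. om q) = 0" "(\<Sum>q\<in>UNIV. om q ^ 2) = 0" "(\<Sum>q\<in>UNIV. om q ^ 3) = 0"
proof -
  define s where "s = complex_of_real (sqrt 2 / 2)"
  have s: "s * s = 1 / 2" unfolding s_def by (rule sqrt2_half_sq)
  have i: "\<i> * \<i> = -1" by simp
  show "(\<Sum>q\<in>UNIV. om q) = 0"
    by (simp add: sum_4 om_explicit)
  have "(s + \<i> * s) ^ 2 + (- s + \<i> * s) ^ 2 + (- s - \<i> * s) ^ 2 + (s - \<i> * s) ^ 2 = 0"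
    using s i by algebra
  then show "(\<Sum>q\<in>UNIV. om q ^ 2) = 0"
    by (simp add: sum_4 om_explicit s_def)
  have "(s + \<i> * s) ^ 3 + (- s + \<i> * s) ^ 3 + (- s - \<i> * s) ^ 3 + (s - \<i> * s) ^ 3 = 0"
    by (simp add: power3_eq_cube algebra_simps)
  then show "(\<Sum>q\<in>UNIV. om q ^ 3) = 0"
    by (simp add: sum_4 om_explicit s_def)
qed

subsection \<open>Linear systems in companion form\<close>

text \<open>The index \<open>p + 1\<close> wraps around to 1 at \<open>p = 4\<close>, which is where
  the factor \<mu> enters.\<close>

definition companion :: "complex \<Rightarrow> complex ^ 4 \<Rightarrow> complex ^ 4" where
  "companion \<mu> v = (\<chi> p. if p = 4 then \<mu> * v $ 1 else v $ (p + 1))"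

lemma companion_simps [simp]:
  "companion \<mu> v $ 1 = v $ 2" "companion \<mu> v $ 2 = v $ 3"
  "companion \<mu> v $ 3 = v $ 4" "companion \<mu> v $ 4 = \<mu> * v $ 1"
  by (simp_all add: companion_def)

text \<open>\<^term>\<open>V\<close> is the vector of a solution of \<open>u'''' = \<mu> u\<close> and its first three derivatives.\<close>

definition solves :: "complex \<Rightarrow> real set \<Rightarrow> (real \<Rightarrow> complex ^ 4) \<Rightarrow> bool" where
  "solves \<mu> S V \<longleftrightarrow>
     (\<forall>x\<in>S. \<forall>p. ((\<lambda>t. V t $ p) has_vector_derivative companion \<mu> (V x) $ p) (at x within S))"

lemma solvesD:
  "solves \<mu> S V \<Longrightarrow> x \<in> S \<Longrightarrow>
    ((\<lambda>t. V t $ p) has_vector_derivative companion \<mu> (V x) $ p) (at x within S)"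
  by (auto simp: solves_def)

lemma solves_subset: "solves \<mu> S V \<Longrightarrow> T \<subseteq> S \<Longrightarrow> solves \<mu> T V"
  unfolding solves_def by (blast intro: has_vector_derivative_within_subset)

lemma solves_continuous_on: "solves \<mu> S V \<Longrightarrow> continuous_on S (\<lambda>t. V t $ p)"
  unfolding continuous_on_eq_continuous_within
  by (blast dest: solvesD intro: has_vector_derivative_continuous)

lemma at_within_Icc_neq_bot:
  fixes a b :: real
  assumes "a < b"
  shows "\<forall>x\<in>{a..b}. at x within {a..b} \<noteq> bot"
  using assms by (simp add: trivial_limit_within islimpt_Icc)

text \<open>\<open>vector_derivative\<close> is a choice operator, so its value is known only where
  derivatives are unique, that is, where \<open>at x within S\<close> is nontrivial.\<close>

lemma nderiv_Suc_eq:
  assumes eq: "\<And>t. t \<in> S \<Longrightarrow> nderiv S n u t = f t"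
    and x: "x \<in> S" and der: "(f has_vector_derivative f') (at x within S)"
    and nt: "at x within S \<noteq> bot"
  shows "(nderiv S n u has_vector_derivative f') (at x within S)"
    and "nderiv S (Suc n) u x = f'"
proof -
  show *: "(nderiv S n u has_vector_derivative f') (at x within S)"
    using has_vector_derivative_transform [OF x _ der] eq by metis
  show "nderiv S (Suc n) u x = f'"
    using vector_derivative_within [OF nt *] by (simp add: nderiv_def)
qed

text \<open>Repeated use of \<open>nderiv_Suc_eq\<close> along the components of \<open>V\<close>.
  It translates the first-order system into the iterated derivatives in which \<open>bvals\<close>,
  \<open>C_on\<close> and \<open>Wlam\<close> are phrased.\<close>

lemma solves_nderiv:
  assumes V: "solves \<mu> S V" and nt: "\<forall>x\<in>S. at x within S \<noteq> bot"
    and u: "\<forall>x\<in>S. u x = V x $ 1" and x: "x \<in> S"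
  shows "nderiv S 0 u x = V x $ 1" "nderiv S 1 u x = V x $ 2" "nderiv S 2 u x = V x $ 3"
    "nderiv S 3 u x = V x $ 4" "nderiv S 4 u x = \<mu> * V x $ 1"
    "(nderiv S 0 u has_vector_derivative V x $ 2) (at x within S)"
    "(nderiv S 1 u has_vector_derivative V x $ 3) (at x within S)"
    "(nderiv S 2 u has_vector_derivative V x $ 4) (at x within S)"
    "(nderiv S 3 u has_vector_derivative \<mu> * V x $ 1) (at x within S)"
proof -
  have 0: "nderiv S 0 u t = V t $ 1" if "t \<in> S" for t
    using u that by (simp add: nderiv_def)
  have d1: "((\<lambda>t. V t $ 1) has_vector_derivative V t $ 2) (at t within S)"
   and d2: "((\<lambda>t. V t $ 2) has_vector_derivative V t $ 3) (at t within S)"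
   and d3: "((\<lambda>t. V t $ 3) has_vector_derivative V t $ 4) (at t within S)"
   and d4: "((\<lambda>t. V t $ 4) has_vector_derivative \<mu> * V t $ 1) (at t within S)" if "t \<in> S" for t
    using solvesD [OF V that, of 1] solvesD [OF V that, of 2]
      solvesD [OF V that, of 3] solvesD [OF V that, of 4] by simp_all
  have 1: "nderiv S 1 u t = V t $ 2" if "t \<in> S" for t
    using nderiv_Suc_eq(2) [OF 0 that d1 [OF that] bspec [OF nt that]] by simp
  have 2: "nderiv S 2 u t = V t $ 3" if "t \<in> S" for t
    using nderiv_Suc_eq(2) [OF 1 that d2 [OF that] bspec [OF nt that]] by (simp add: numeral_2_eq_2)
  have 3: "nderiv S 3 u t = V t $ 4" if "t \<in> S" for t
    using nderiv_Suc_eq(2) [OF 2 that d3 [OF that] bspec [OF nt that]] by (simp add: numeral_3_eq_3)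
  have 4: "nderiv S 4 u t = \<mu> * V t $ 1" if "t \<in> S" for t
    using nderiv_Suc_eq(2) [OF 3 that d4 [OF that] bspec [OF nt that]] by simp
  show "nderiv S 0 u x = V x $ 1" "nderiv S 1 u x = V x $ 2" "nderiv S 2 u x = V x $ 3"
    "nderiv S 3 u x = V x $ 4" "nderiv S 4 u x = \<mu> * V x $ 1"
    using 0 1 2 3 4 x by blast+
  show "(nderiv S 0 u has_vector_derivative V x $ 2) (at x within S)"
    by (rule nderiv_Suc_eq(1) [OF 0 x d1 [OF x] bspec [OF nt x]])
  show "(nderiv S 1 u has_vector_derivative V x $ 3) (at x within S)"
    by (rule nderiv_Suc_eq(1) [OF 1 x d2 [OF x] bspec [OF nt x]])
  show "(nderiv S 2 u has_vector_derivative V x $ 4) (at x within S)"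
    by (rule nderiv_Suc_eq(1) [OF 2 x d3 [OF x] bspec [OF nt x]])
  show "(nderiv S 3 u has_vector_derivative \<mu> * V x $ 1) (at x within S)"
    by (rule nderiv_Suc_eq(1) [OF 3 x d4 [OF x] bspec [OF nt x]])
qed

text \<open>\<^term>\<open>F\<close> is a fundamental matrix of \<open>V' = companion \<mu> V\<close> with inverse \<^term>\<open>R\<close>; the rows of
  \<^term>\<open>R\<close> solve the adjoint system, so that \<open>R V\<close> is constant for each solution \<open>V\<close>.\<close>

definition fundamental ::
    "complex \<Rightarrow> (real \<Rightarrow> complex ^ 4 ^ 4) \<Rightarrow> (real \<Rightarrow> complex ^ 4 ^ 4) \<Rightarrow> bool" where
  "fundamental \<mu> F R \<longleftrightarrow> (\<forall>c. solves \<mu> UNIV (\<lambda>x. F x *v c)) \<and> (\<forall>x. R x ** F x = mat 1) \<and>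
     (\<forall>x q. ((\<lambda>t. R t $ q $ 1) has_vector_derivative - \<mu> * R x $ q $ 4) (at x) \<and>
            ((\<lambda>t. R t $ q $ 2) has_vector_derivative - R x $ q $ 1) (at x) \<and>
            ((\<lambda>t. R t $ q $ 3) has_vector_derivative - R x $ q $ 2) (at x) \<and>
            ((\<lambda>t. R t $ q $ 4) has_vector_derivative - R x $ q $ 3) (at x))"

lemma fundamental_solves: "fundamental \<mu> F R \<Longrightarrow> solves \<mu> S (\<lambda>x. F x *v c)"
  unfolding fundamental_def using solves_subset by blast

lemma matrix_inv_invertible:
  fixes A :: "'a::semiring_1 ^ 'n ^ 'n"
  assumes "invertible A"
  shows "A ** matrix_inv A = mat 1" "matrix_inv A ** A = mat 1"
  using someI_ex [OF assms [unfolded invertible_def]] by (simp_all add: matrix_inv_def)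

lemma fundamental_inverse:
  assumes "fundamental \<mu> F R"
  shows "R x ** F x = mat 1" "F x ** R x = mat 1" "invertible (F x)" "matrix_inv (F x) = R x"
proof -
  show 1: "R x ** F x = mat 1"
    using assms by (auto simp: fundamental_def)
  then show 2: "F x ** R x = mat 1"
    using matrix_left_right_inverse by blast
  show inv: "invertible (F x)"
    using 1 2 by (auto simp: invertible_def)
  show "matrix_inv (F x) = R x"
    using matrix_inv_invertible(2) [OF inv] 2
    by (metis matrix_mul_assoc matrix_mul_lid matrix_mul_rid)
qed

text \<open>By the adjoint equations all terms in the derivative of \<open>R V\<close> cancel; its
  constant value on the convex set is the coefficient vector.\<close>

lemma fundamental_solution:
  assumes F: "fundamental \<mu> F R" and S: "convex S" and V: "solves \<mu> S V"
  obtains c where "\<And>x. x \<in> S \<Longrightarrow> V x = F x *v c"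
proof -
  have "\<exists>a. \<forall>x\<in>S. (R x *v V x) $ q = a" for q
  proof -
    have "((\<lambda>t. (R t *v V t) $ q) has_vector_derivative 0) (at x within S)" if x: "x \<in> S" for x
    proof -
      have R: "((\<lambda>t. R t $ q $ 1) has_vector_derivative - \<mu> * R x $ q $ 4) (at x within S)"
            "((\<lambda>t. R t $ q $ 2) has_vector_derivative - R x $ q $ 1) (at x within S)"
            "((\<lambda>t. R t $ q $ 3) has_vector_derivative - R x $ q $ 2) (at x within S)"
            "((\<lambda>t. R t $ q $ 4) has_vector_derivative - R x $ q $ 3) (at x within S)"
        using F by (auto simp: fundamental_def intro: has_vector_derivative_at_within)
      show ?thesis
        unfolding matrix_vector_mult_def vec_lambda_beta sum_4
        by (rule has_vector_derivative_eq_rhs,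
            (rule has_vector_derivative_add has_vector_derivative_mult R solvesD [OF V x])+)
          (simp add: algebra_simps)
    qed
    from has_vector_derivative_zero_constant [OF S this] show ?thesis by metis
  qed
  then obtain a where a: "\<And>q x. x \<in> S \<Longrightarrow> (R x *v V x) $ q = a q" by metis
  show ?thesis
  proof
    fix x assume "x \<in> S"
    then have "R x *v V x = (\<chi> q. a q)"
      by (simp add: vec_eq_iff a)
    then show "V x = F x *v (\<chi> q. a q)"
      by (metis fundamental_inverse(2) [OF F] matrix_vector_mul_assoc matrix_vector_mul_lid)
  qed
qed

section \<open>Explicit fundamental matrices: exponentials and polynomials\<close>

definition expmat :: "complex \<Rightarrow> real \<Rightarrow> complex ^ 4 ^ 4" where
  "expmat \<rho> x = (\<chi> p q. (om q * \<rho>) ^ (ix p - 1) * exp (om q * \<rho> * of_real x))"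

text \<open>The nodes \<open>om q * \<rho>\<close> are the four roots of one equation z^4 = const,
  so the Vandermonde matrix is inverted as in a discrete Fourier transform: transpose, take
  reciprocals of the entries, divide by 4.\<close>

definition expmat_inv :: "complex \<Rightarrow> real \<Rightarrow> complex ^ 4 ^ 4" where
  "expmat_inv \<rho> x = (\<chi> q p. inverse (om q * \<rho>) ^ (ix p - 1) * exp (- om q * \<rho> * of_real x) / 4)"

lemma has_vector_derivative_exp_line:
  fixes c :: complex
  shows "((\<lambda>t. exp (c * of_real t)) has_vector_derivative c * exp (c * of_real x)) (at x within S)"
proof -
  have "((\<lambda>z. exp (c * z)) has_field_derivative c * exp (c * of_real x)) (at (of_real x))"
    by (auto intro!: derivative_eq_intros)
  from has_vector_derivative_real_field [OF this] show ?thesis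
    by (rule has_vector_derivative_at_within)
qed

lemma W_eq_expmat: "W \<alpha> x = expmat (of_real \<alpha>) x"
  by (simp add: W_def expmat_def om_def)

lemma fundamental_expmat:
  assumes \<rho>: "\<rho> \<noteq> 0" and \<mu>: "\<mu> = - (\<rho> ^ 4)"
  shows "fundamental \<mu> (expmat \<rho>) (expmat_inv \<rho>)"
  unfolding fundamental_def
proof (intro conjI allI)
  have pw: "(om q * \<rho>) ^ 4 = \<mu>" for q
    by (simp add: power_mult_distrib om_pow4 \<mu>)
  have D: "((\<lambda>t. (om q * \<rho>) ^ n * exp (om q * \<rho> * of_real t) * c) has_vector_derivative
      (om q * \<rho>) ^ Suc n * exp (om q * \<rho> * of_real x) * c) (at x)" for n q c and x :: real
  proof -
    have "((\<lambda>t. ((om q * \<rho>) ^ n * c) * exp (om q * \<rho> * of_real t)) has_vector_derivative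
      ((om q * \<rho>) ^ n * c) * (om q * \<rho> * exp (om q * \<rho> * of_real x))) (at x)"
      by (rule has_vector_derivative_mult_right [OF has_vector_derivative_exp_line])
    then show ?thesis by (simp add: ac_simps)
  qed
  show "solves \<mu> UNIV (\<lambda>x. expmat \<rho> x *v c)" for c
    unfolding solves_def
  proof (intro ballI allI)
    fix x :: real and p :: 4
    have "((\<lambda>t. (expmat \<rho> t *v c) $ p) has_vector_derivative
       (\<Sum>q\<in>UNIV. (om q * \<rho>) ^ Suc (ix p - 1) * exp (om q * \<rho> * of_real x) * c $ q)) (at x)"
      unfolding matrix_vector_mult_def vec_lambda_beta expmat_def
      by (rule has_vector_derivative_sum) (rule D)
    moreover have "(\<Sum>q\<in>UNIV. (om q * \<rho>) ^ Suc (ix p - 1) * exp (om q * \<rho> * of_real x) * c $ q)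
      = companion \<mu> (expmat \<rho> x *v c) $ p"
    proof (cases "p = 4")
      case True
      have *: "Suc (ix p - 1) = 4" using True by simp
      show ?thesis
        unfolding * pw using True
        by (simp add: expmat_def matrix_vector_mult_def sum_distrib_left mult_ac)
    next
      case False
      \<comment> \<open>Row \<open>p\<close> carries the power \<open>ix p - 1\<close>, so
        differentiating once means passing to the next row.\<close>
      then have *: "Suc (ix p - 1) = ix (p + 1) - 1"
        using exhaust_4 [of p] by auto
      show ?thesis
        unfolding * using False
        by (simp add: expmat_def matrix_vector_mult_def companion_def)
    qed
    ultimately show "((\<lambda>t. (expmat \<rho> t *v c) $ p) has_vector_derivative
        companion \<mu> (expmat \<rho> x *v c) $ p) (at x within UNIV)"
      by simp
  qed
  show "expmat_inv \<rho> x ** expmat \<rho> x = mat 1" for x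
  proof -
    have "(expmat_inv \<rho> x ** expmat \<rho> x) $ q $ r = (if q = r then 1 else 0)" for q r
    proof -
      let ?t = "om r / om q"
      have "inverse (om q * \<rho>) * (om r * \<rho>) = ?t"
        using \<rho> by (simp add: field_simps)
      then have t: "inverse (om q * \<rho>) ^ n * (om r * \<rho>) ^ n = ?t ^ n" for n
        by (metis power_mult_distrib)
      have "(expmat_inv \<rho> x ** expmat \<rho> x) $ q $ r =
        (\<Sum>p\<in>UNIV. (inverse (om q * \<rho>) ^ (ix p - 1) * (om r * \<rho>) ^ (ix p - 1)) *
           (exp (- om q * \<rho> * of_real x) * exp (om r * \<rho> * of_real x) / 4))"
        unfolding matrix_matrix_mult_def expmat_inv_def expmat_def vec_lambda_beta
        by (rule sum.cong) simp_all
      also have "\<dots> = (1 + ?t + ?t ^ 2 + ?t ^ 3) *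
           (exp (- om q * \<rho> * of_real x) * exp (om r * \<rho> * of_real x) / 4)"
        unfolding t by (simp add: sum_4 distrib_right)
      also have "\<dots> = (if q = r then 1 else 0)"
      proof (cases "q = r")
        case True
        then show ?thesis by (simp add: exp_minus)
      next
        case False
        \<comment> \<open>The quotient of two roots is a fourth root of unity, so the geometric sum
          vanishes unless the quotient is 1.\<close>
        have "?t ^ 4 = 1" by (simp add: power_divide om_pow4)
        moreover have "(z - 1) * (1 + z + z ^ 2 + z ^ 3) = z ^ 4 - 1" for z :: complex
          by algebra
        ultimately have "(?t - 1) * (1 + ?t + ?t ^ 2 + ?t ^ 3) = 0" by simp
        moreover have "?t \<noteq> 1" using om_inj [OF False] by (simp add: field_simps)
        ultimately show ?thesis using False by simp
      qed
      finally show ?thesis .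
    qed
    then show ?thesis by (simp add: vec_eq_iff mat_def)
  qed
  fix x q
  \<comment> \<open>Row \<open>q\<close> of the inverse consists of the powers of
    \<open>inverse a\<close> times \<open>e\<close>. Differentiation multiplies it by
    \<open>- a\<close>, which lowers the power by one, and \<open>\<mu> = a ^ 4\<close> closes the
    cycle in the first column.\<close>
  define a where "a = om q * \<rho>"
  define e where "e = (\<lambda>t. exp (- om q * \<rho> * complex_of_real t) / 4)"
  have a: "a \<noteq> 0" using \<rho> by (simp add: a_def)
  have ai: "a * (inverse a * z) = z" for z
    using a by simp
  have R: "expmat_inv \<rho> t $ q $ p = inverse a ^ (ix p - 1) * e t" for t p
    by (simp add: expmat_inv_def a_def e_def)
  have De: "((\<lambda>t. c * e t) has_vector_derivative c * (- a * e x)) (at x)" for c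
  proof -
    have "((\<lambda>t. (c / 4) * exp (- om q * \<rho> * of_real t)) has_vector_derivative
      (c / 4) * (- om q * \<rho> * exp (- om q * \<rho> * of_real x))) (at x)"
      by (rule has_vector_derivative_mult_right [OF has_vector_derivative_exp_line])
    then show ?thesis by (simp add: a_def e_def)
  qed
  have \<mu>a: "\<mu> = a * a * a * a"
    using pw [of q] by (simp add: a_def power4_eq_xxxx)
  show "((\<lambda>t. expmat_inv \<rho> t $ q $ 1) has_vector_derivative - \<mu> * expmat_inv \<rho> x $ q $ 4) (at x)"
    "((\<lambda>t. expmat_inv \<rho> t $ q $ 2) has_vector_derivative - expmat_inv \<rho> x $ q $ 1) (at x)"
    "((\<lambda>t. expmat_inv \<rho> t $ q $ 3) has_vector_derivative - expmat_inv \<rho> x $ q $ 2) (at x)"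
    "((\<lambda>t. expmat_inv \<rho> t $ q $ 4) has_vector_derivative - expmat_inv \<rho> x $ q $ 3) (at x)"
    unfolding R
    by (rule has_vector_derivative_eq_rhs [OF De],
        use a in \<open>simp add: \<mu>a ai power2_eq_square power3_eq_cube mult.assoc\<close>)+
qed

text \<open>This is exp (x N) for the nilpotent companion matrix N belonging to \<mu> = 0, whence
  the inverse \<open>polymat (- x)\<close>.\<close>

definition polymat :: "real \<Rightarrow> complex ^ 4 ^ 4" where
  "polymat x = (let z = complex_of_real x in
     vector [vector [1, z, z ^ 2 / 2, z ^ 3 / 6], vector [0, 1, z, z ^ 2 / 2],
             vector [0, 0, 1, z], vector [0, 0, 0, 1]])"

lemma fundamental_polymat: "fundamental 0 polymat (\<lambda>x. polymat (- x))"
  unfolding fundamental_def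
proof (intro conjI allI)
  have P1: "((\<lambda>t. complex_of_real t) has_vector_derivative 1) (at x within S)" for x S
    using has_vector_derivative_of_real [OF DERIV_ident] by simp
  have P2: "((\<lambda>t. (complex_of_real t)\<^sup>2 / 2) has_vector_derivative of_real x) (at x within S)" for x S
    using has_vector_derivative_mult [OF P1 P1, THEN has_vector_derivative_divide, of 2 x S]
    by (simp add: power2_eq_square)
  have P3: "((\<lambda>t. (complex_of_real t) ^ 3 / 6) has_vector_derivative (of_real x)\<^sup>2 / 2) (at x within S)"
    for x S
    using has_vector_derivative_mult [OF P1 P2, THEN has_vector_derivative_divide, of 3 x S]
    by (simp add: power2_eq_square power3_eq_cube mult.assoc)
  show "solves 0 UNIV (\<lambda>x. polymat x *v c)" for c
    unfolding solves_def forall_4 companion_simps matrix_vector_mult_def vec_lambda_beta sum_4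
      polymat_def Let_def vector_4
    by (intro ballI conjI; rule has_vector_derivative_eq_rhs,
       (rule has_vector_derivative_add has_vector_derivative_mult_left P1 P2 P3
          has_vector_derivative_const)+, simp)
  show "polymat (- x) ** polymat x = mat 1" for x
    by (simp add: vec_eq_iff forall_4 matrix_matrix_mult_def sum_4 polymat_def Let_def mat_def,
        simp add: power2_eq_square power3_eq_cube field_simps)
  fix x :: real and q :: 4
  show "((\<lambda>t. polymat (- t) $ q $ 1) has_vector_derivative - 0 * polymat (- x) $ q $ 4) (at x)"
    "((\<lambda>t. polymat (- t) $ q $ 2) has_vector_derivative - polymat (- x) $ q $ 1) (at x)"
    "((\<lambda>t. polymat (- t) $ q $ 3) has_vector_derivative - polymat (- x) $ q $ 2) (at x)"
    "((\<lambda>t. polymat (- t) $ q $ 4) has_vector_derivative - polymat (- x) $ q $ 3) (at x)"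
    using exhaust_4 [of q] P1 [of x UNIV] P2 [of x UNIV]
      P1 [of x UNIV, THEN has_vector_derivative_minus]
      P3 [of x UNIV, THEN has_vector_derivative_minus]
    by (elim disjE; simp add: polymat_def Let_def)+
qed

subsection \<open>The matrices \<open>W\<close>, \<open>Wlam\<close> and \<open>Mtilde\<close>\<close>

text \<open>\<open>chi\<close> is a definite description, so unique existence has to come first.
  \<open>Arg2pi\<close> takes values in [0, 2 pi), and a quarter of it is exactly the range allowed
  for the argument of the root.\<close>

lemma chi_pow4:
  assumes lam: "lam \<noteq> 0" "lam \<noteq> 1 / of_real k" and k: "k > 0"
  shows "chi k lam ^ 4 = 1 - 1 / (lam * of_real k)" "chi k lam \<noteq> 0"
proof -
  define z where "z = 1 - 1 / (lam * of_real k)"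
  have z: "z \<noteq> 0"
    using lam k by (auto simp: z_def field_simps)
  let ?P = "\<lambda>\<kappa>. \<kappa> ^ 4 = z \<and> 0 \<le> Arg \<kappa> \<and> Arg \<kappa> < pi / 2"
  have "\<exists>!\<kappa>. ?P \<kappa>"
  proof
    define r where "r = root 4 (cmod z)"
    define \<kappa> where "\<kappa> = of_real r * exp (\<i> * of_real (Arg2pi z / 4))"
    have r: "r > 0" "r ^ 4 = cmod z"
      using z by (simp_all add: r_def)
    have "\<kappa> ^ 4 = of_real (r ^ 4) * exp (of_nat 4 * (\<i> * of_real (Arg2pi z / 4)))"
      unfolding \<kappa>_def power_mult_distrib exp_of_nat_mult by simp
    also have "\<dots> = z"
      using Arg2pi_eq [of z] by (simp add: r)
    finally have "\<kappa> ^ 4 = z" .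
    moreover have "Arg \<kappa> = Arg2pi z / 4"
      by (rule Arg_unique [OF \<kappa>_def [symmetric] r(1)])
        (use Arg2pi_ge_0 [of z] Arg2pi_lt_2pi [of z] pi_gt_zero in linarith)+
    ultimately show "?P \<kappa>"
      using Arg2pi_ge_0 [of z] Arg2pi_lt_2pi [of z] by simp
    show "v = \<kappa>" if v: "?P v" for v
    proof -
      \<comment> \<open>Uniqueness: \<open>4 * Arg v\<close> lies in [0, 2 pi) and hence is
        \<open>Arg2pi z\<close>, so argument and modulus of \<open>v\<close> are determined.\<close>
      have "v \<noteq> 0" using v z by auto
      have "of_real (cmod v ^ 4) * exp (\<i> * of_real (4 * Arg v)) =
          (of_real (cmod v) * exp (\<i> * of_real (Arg v))) ^ 4"
        unfolding power_mult_distrib exp_of_nat_mult [symmetric] by (simp add: mult_ac)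
      also have "\<dots> = z"
        using v Arg_eq [OF \<open>v \<noteq> 0\<close>] by simp
      finally have "Arg2pi z = 4 * Arg v"
        by (rule Arg2pi_unique) (use \<open>v \<noteq> 0\<close> v in auto)
      moreover have "cmod v ^ 4 = r ^ 4"
        using v by (simp add: r flip: norm_power)
      then have "cmod v = r"
        using r by (metis norm_ge_zero less_imp_le power_eq_imp_eq_base zero_less_numeral)
      ultimately show ?thesis
        using Arg_eq [OF \<open>v \<noteq> 0\<close>] by (simp add: \<kappa>_def)
    qed
  qed
  from theI' [OF this] show 1: "chi k lam ^ 4 = 1 - 1 / (lam * of_real k)"
    by (simp add: chi_def z_def)
  with z show "chi k lam \<noteq> 0"
    by (auto simp: z_def)
qed

text \<open>Substituting \<open>w = u / lam\<close> into u'''' + \<alpha>^4 u = (\<alpha>^4 / k) w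
  gives u'''' = \<open>mu\<close> u.\<close>

definition mu :: "real \<Rightarrow> real \<Rightarrow> complex \<Rightarrow> complex" where
  "mu \<alpha> k lam = of_real (\<alpha> ^ 4) * (1 / (lam * of_real k) - 1)"

lemma matrix_vector_mult_axis:
  fixes A :: "'a::semiring_1 ^ 'n ^ 'm"
  shows "(A *v axis q 1) $ p = A $ p $ q"
  by (simp add: matrix_vector_mult_def axis_def if_distrib cong: if_cong)

lemma det_eq_0_iff_kernel:
  fixes A :: "'a::field ^ 'n ^ 'n"
  shows "det A = 0 \<longleftrightarrow> (\<exists>c. c \<noteq> 0 \<and> A *v c = 0)"
  using matrix_left_invertible_ker [of A] invertible_det_nz [of A] invertible_left_inverse [of A]
  by blast

lemma matrix_add_rdistrib:
  fixes A B :: "'a::semiring_1 ^ 'n ^ 'm" and C :: "'a ^ 'p ^ 'n"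
  shows "(A + B) ** C = A ** C + B ** C"
  by (simp add: vec_eq_iff matrix_matrix_mult_def distrib_right sum.distrib)

lemma matrix_diff_distrib:
  fixes A B :: "'a::ring_1 ^ 'n ^ 'm" and C D :: "'a ^ 'p ^ 'n"
  shows "(A - B) ** C = A ** C - B ** C" "A ** (C - D) = A ** C - A ** D"
  by (simp_all add: vec_eq_iff matrix_matrix_mult_def left_diff_distrib right_diff_distrib sum_subtractf)

text \<open>Both matrices are recovered from their first rows by differentiation, so comparing the
  first rows suffices.\<close>

lemma Wlam_eqI:
  assumes F: "fundamental \<mu> F R" and y: "\<And>q x. ylam \<alpha> k lam (ix q) x = F x $ 1 $ q"
  shows "Wlam \<alpha> k lam = F"
proof -
  have "nderiv UNIV (ix p - 1) (ylam \<alpha> k lam (ix q)) x = F x $ p $ q" for x p q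
  proof -
    have "\<forall>x\<in>UNIV. ylam \<alpha> k lam (ix q) x = (F x *v axis q 1) $ 1"
      by (simp add: matrix_vector_mult_axis y)
    note * = solves_nderiv(1-4) [OF fundamental_solves [OF F] _ this, of x,
        unfolded matrix_vector_mult_axis]
    show ?thesis
      using exhaust_4 [of p] by (elim disjE) (simp_all add: * * [unfolded One_nat_def])
  qed
  then show ?thesis
    by (simp add: Wlam_def fun_eq_iff vec_eq_iff)
qed

text \<open>Exponentials serve for \<open>lam \<noteq> 1 / k\<close>. At \<open>lam = 1 / k\<close>,
  where \<open>mu\<close> vanishes, the basis \<open>ylam\<close> is polynomial.\<close>

lemma fundamental_Wlam:
  assumes lam: "lam \<noteq> 0" and k: "k > 0" and \<alpha>: "\<alpha> > 0"
  obtains R where "fundamental (mu \<alpha> k lam) (Wlam \<alpha> k lam) R"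
proof (cases "lam = 1 / of_real k")
  case True
  have "Wlam \<alpha> k lam = polymat"
  proof (rule Wlam_eqI [OF fundamental_polymat])
    show "ylam \<alpha> k lam (ix q) x = polymat x $ 1 $ q" for q x
      using exhaust_4 [of q] True
      by (elim disjE) (simp_all add: ylam_def polymat_def Let_def fact_numeral)
  qed
  moreover have "mu \<alpha> k lam = 0"
    using True k by (simp add: mu_def)
  ultimately show ?thesis
    using fundamental_polymat that by metis
next
  case False
  define \<rho> where "\<rho> = chi k lam * of_real \<alpha>"
  note chi = chi_pow4 [OF lam False k]
  have *: "fundamental (mu \<alpha> k lam) (expmat \<rho>) (expmat_inv \<rho>)"
    using \<alpha> chi by (intro fundamental_expmat)
      (simp_all add: \<rho>_def mu_def power_mult_distrib left_diff_distrib right_diff_distrib)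
  have "Wlam \<alpha> k lam = expmat \<rho>"
    by (rule Wlam_eqI [OF *]) (use False in \<open>simp add: ylam_def expmat_def om_def \<rho>_def mult.assoc\<close>)
  with * that show ?thesis by metis
qed

lemma fundamental_W:
  assumes "\<alpha> > 0"
  shows "fundamental (- of_real (\<alpha> ^ 4)) (W \<alpha>) (expmat_inv (of_real \<alpha>))"
  unfolding W_eq_expmat [abs_def]
  using assms by (intro fundamental_expmat) simp_all

lemma matrix_bvals:
  assumes "bvals l u = vector [U $ 1, U $ 2, U $ 3, U $ 4, V $ 1, V $ 2, V $ 3, V $ 4]"
  shows "M *v bvals l u = Mminus M *v U + Mplus M *v V"
proof -
  have "(8::8) = 0" by simp
  then show ?thesis
    unfolding assms
    by (simp add: vec_eq_iff matrix_vector_mult_def sum_8 sum_4 Mminus_def Mplus_def del: num1_eq1)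
qed

lemma solves_bvals:
  assumes "solves \<mu> {-l..l} V" "l > 0" "\<forall>x\<in>{-l..l}. u x = V x $ 1"
  shows "M *v bvals l u = Mminus M *v V (-l) + Mplus M *v V l"
proof (rule matrix_bvals)
  note * = solves_nderiv(1-4) [OF assms(1) at_within_Icc_neq_bot assms(3)]
  show "bvals l u = vector [V (-l) $ 1, V (-l) $ 2, V (-l) $ 3, V (-l) $ 4,
      V l $ 1, V l $ 2, V l $ 3, V l $ 4]"
    using assms(2) by (simp add: bvals_def Let_def * del: One_nat_def)
qed

lemma Mtilde_mult_vec:
  "Mtilde l \<alpha> M *v c = Mminus M *v (W \<alpha> (-l) *v c) + Mplus M *v (W \<alpha> l *v c)"
  by (simp add: Mtilde_def Mtilde_minus_def Mtilde_plus_def matrix_vector_mult_add_rdistrib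
      matrix_vector_mul_assoc)

text \<open>On a nondegenerate interval derivatives are unique even at the endpoints, so vanishing
  passes from each component to the next.\<close>

lemma solves_eq_0:
  assumes V: "solves \<mu> {a..b} V" and ab: "a < b" and 0: "\<And>x. x \<in> {a..b} \<Longrightarrow> V x $ 1 = 0"
    and x: "x \<in> {a..b}"
  shows "V x = 0"
proof -
  have *: "f' = 0" if "\<And>t. t \<in> {a..b} \<Longrightarrow> f t = 0" "(f has_vector_derivative f') (at t within {a..b})"
    "t \<in> {a..b}" for f :: "real \<Rightarrow> complex" and f' t
  proof -
    have "((\<lambda>_. 0) has_vector_derivative f') (at t within {a..b})"
      by (rule has_vector_derivative_transform [OF that(3) _ that(2)]) (simp add: that(1))
    then show ?thesis
      using vector_derivative_unique_within
        [OF bspec [OF at_within_Icc_neq_bot [OF ab] that(3)] _ has_vector_derivative_const]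
      by blast
  qed
  have 1: "V t $ 2 = 0" if "t \<in> {a..b}" for t
    using * [OF 0 _ that] solvesD [OF V that, of 1] by simp
  have 2: "V t $ 3 = 0" if "t \<in> {a..b}" for t
    using * [OF 1 _ that] solvesD [OF V that, of 2] by simp
  have 3: "V t $ 4 = 0" if "t \<in> {a..b}" for t
    using * [OF 2 _ that] solvesD [OF V that, of 3] by simp
  show ?thesis
    using 0 1 2 3 x by (simp add: vec_eq_iff forall_4)
qed

text \<open>Linear independence of the first row of \<open>F\<close>: a nonzero coefficient vector
  gives a nonzero function.\<close>

lemma fundamental_eq_0:
  assumes F: "fundamental \<mu> F R" and ab: "a < b" and 0: "\<And>x. x \<in> {a..b} \<Longrightarrow> (F x *v c) $ 1 = 0"
  shows "c = 0"
proof -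
  have "F a *v c = 0"
    using solves_eq_0 [OF fundamental_solves [OF F] ab 0] ab by simp
  then show ?thesis
    by (metis fundamental_inverse(1) [OF F] matrix_vector_mul_assoc matrix_vector_mul_lid
        matrix_vector_mult_0_right)
qed

text \<open>A kernel vector \<open>c\<close> would make \<open>W c\<close> a nonzero solution
  satisfying the boundary conditions. Well-posedness enters the proof only through this
  invertibility.\<close>

lemma wp_invertible_Mtilde:
  assumes l: "l > 0" and \<alpha>: "\<alpha> > 0" and M: "M \<in> wp l \<alpha>"
  shows "invertible (Mtilde l \<alpha> M)"
  unfolding invertible_det_nz
proof
  assume "det (Mtilde l \<alpha> M) = 0"
  then obtain c where c: "c \<noteq> 0" "Mtilde l \<alpha> M *v c = 0"
    by (auto simp: det_eq_0_iff_kernel)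
  define V where "V = (\<lambda>x. W \<alpha> x *v c)"
  define u where "u = (\<lambda>x. V x $ 1)"
  note F = fundamental_W [OF \<alpha>]
  have V: "solves (- of_real (\<alpha> ^ 4)) {-l..l} V"
    unfolding V_def by (rule fundamental_solves [OF F])
  have u: "\<forall>x\<in>{-l..l}. u x = V x $ 1" by (simp add: u_def)
  note n = solves_nderiv [OF V at_within_Icc_neq_bot u]
  have "nderiv {-l..l} i u differentiable (at x within {-l..l})" if "i < 4" "x \<in> {-l..l}" for i x
  proof -
    consider "i = 0" | "i = 1" | "i = 2" | "i = 3" using \<open>i < 4\<close> by linarith
    then show ?thesis
      using n(6-9) [of x] l that(2) by cases (auto intro: differentiableI_vector)
  qed
  moreover have "continuous_on {-l..l} (nderiv {-l..l} 4 u)"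
  proof -
    have "continuous_on {-l..l} (\<lambda>x. (- of_real (\<alpha> ^ 4)) * V x $ 1)"
      by (intro continuous_intros solves_continuous_on [OF V])
    then show ?thesis
      by (rule continuous_on_eq) (use n(5) l in simp)
  qed
  ultimately have "u \<in> C_on 4 {-l..l}"
    by (auto simp: C_on_def)
  moreover have "nderiv {-l..l} 4 u x + of_real (\<alpha> ^ 4) * u x = 0" if "x \<in> {-l..l}" for x
    using n(5) [of x] that l by (simp add: u_def)
  moreover have "M *v bvals l u = 0"
    using c(2) by (simp add: solves_bvals [OF V l u] Mtilde_mult_vec V_def)
  ultimately have "V x $ 1 = 0" if "x \<in> {-l..l}" for x
    using M that by (auto simp: wp_def u_def)
  then have "c = 0"
    using fundamental_eq_0 [OF F, of "-l" l c] l by (auto simp: V_def)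
  with c show False by simp
qed

section \<open>The special boundary matrix \<open>Q\<close>\<close>

text \<open>Up to scaling, the rows of \<open>Q\<close> are cubics in the exponent. With z^4 + 1 =
  (z^2 - r z + 1) (z^2 + r z + 1), those at \<open>-l\<close> are multiples of the first factor,
  whose roots are \<open>om 1\<close> and \<open>om 4\<close>; those at \<open>l\<close> are
  multiples of the second, whose roots are \<open>om 2\<close> and \<open>om 3\<close>.\<close>

lemma om_quadratic:
  defines "r \<equiv> complex_of_real (sqrt 2)"
  shows "om 1 - r * om 1 ^ 2 + om 1 ^ 3 = 0" "om 4 - r * om 4 ^ 2 + om 4 ^ 3 = 0"
    "om 2 - r * om 2 ^ 2 + om 2 ^ 3 = 2 * \<i> * r" "om 3 - r * om 3 ^ 2 + om 3 ^ 3 = - 2 * \<i> * r"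
    "r - om 1 + om 1 ^ 3 = 0" "r - om 4 + om 4 ^ 3 = 0"
    "r - om 2 + om 2 ^ 3 = 2 * r" "r - om 3 + om 3 ^ 3 = 2 * r"
    "om 2 + r * om 2 ^ 2 + om 2 ^ 3 = 0" "om 3 + r * om 3 ^ 2 + om 3 ^ 3 = 0"
    "om 1 + r * om 1 ^ 2 + om 1 ^ 3 = 2 * \<i> * r" "om 4 + r * om 4 ^ 2 + om 4 ^ 3 = - 2 * \<i> * r"
    "- r - om 2 + om 2 ^ 3 = 0" "- r - om 3 + om 3 ^ 3 = 0"
    "- r - om 1 + om 1 ^ 3 = - 2 * r" "- r - om 4 + om 4 ^ 3 = - 2 * r"
proof -
  define s where "s = complex_of_real (sqrt 2 / 2)"
  have s: "s * s = 1 / 2" unfolding s_def by (rule sqrt2_half_sq)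
  have r: "r = 2 * s" by (simp add: r_def s_def)
  have i: "\<i> * \<i> = -1" by simp
  note om = om_explicit [folded s_def]
  show "om 1 - r * om 1 ^ 2 + om 1 ^ 3 = 0" unfolding r om using s i by algebra
  show "om 4 - r * om 4 ^ 2 + om 4 ^ 3 = 0" unfolding r om using s i by algebra
  show "om 2 - r * om 2 ^ 2 + om 2 ^ 3 = 2 * \<i> * r" unfolding r om using s i by algebra
  show "om 3 - r * om 3 ^ 2 + om 3 ^ 3 = - 2 * \<i> * r" unfolding r om using s i by algebra
  show "r - om 1 + om 1 ^ 3 = 0" unfolding r om using s i by algebra
  show "r - om 4 + om 4 ^ 3 = 0" unfolding r om using s i by algebra
  show "r - om 2 + om 2 ^ 3 = 2 * r" unfolding r om using s i by algebra
  show "r - om 3 + om 3 ^ 3 = 2 * r" unfolding r om using s i by algebra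
  show "om 2 + r * om 2 ^ 2 + om 2 ^ 3 = 0" unfolding r om using s i by algebra
  show "om 3 + r * om 3 ^ 2 + om 3 ^ 3 = 0" unfolding r om using s i by algebra
  show "om 1 + r * om 1 ^ 2 + om 1 ^ 3 = 2 * \<i> * r" unfolding r om using s i by algebra
  show "om 4 + r * om 4 ^ 2 + om 4 ^ 3 = - 2 * \<i> * r" unfolding r om using s i by algebra
  show "- r - om 2 + om 2 ^ 3 = 0" unfolding r om using s i by algebra
  show "- r - om 3 + om 3 ^ 3 = 0" unfolding r om using s i by algebra
  show "- r - om 1 + om 1 ^ 3 = - 2 * r" unfolding r om using s i by algebra
  show "- r - om 4 + om 4 ^ 3 = - 2 * r" unfolding r om using s i by algebra
qed

lemma Mtilde_Q_entries:
  fixes \<alpha> l :: real and q :: 4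
  defines "r \<equiv> complex_of_real (sqrt 2)" and "e \<equiv> exp (om q * of_real \<alpha> * of_real l)"
    and "e' \<equiv> exp (- (om q * of_real \<alpha> * of_real l))" and "a \<equiv> complex_of_real \<alpha>"
  shows "Mtilde_minus l \<alpha> (Q \<alpha>) $ 1 $ q = a ^ 3 * e' * (om q - r * om q ^ 2 + om q ^ 3)"
    "Mtilde_minus l \<alpha> (Q \<alpha>) $ 2 $ q = a ^ 3 * e' * (r - om q + om q ^ 3)"
    "Mtilde_minus l \<alpha> (Q \<alpha>) $ 3 $ q = 0" "Mtilde_minus l \<alpha> (Q \<alpha>) $ 4 $ q = 0"
    "Mtilde_plus l \<alpha> (Q \<alpha>) $ 1 $ q = 0" "Mtilde_plus l \<alpha> (Q \<alpha>) $ 2 $ q = 0"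
    "Mtilde_plus l \<alpha> (Q \<alpha>) $ 3 $ q = a ^ 3 * e * (om q + r * om q ^ 2 + om q ^ 3)"
    "Mtilde_plus l \<alpha> (Q \<alpha>) $ 4 $ q = a ^ 3 * e * (- r - om q + om q ^ 3)"
proof -
  \<comment> \<open>The last entry must also be accessible under the index 0.\<close>
  have 8: "(8::8) = 0" by simp
  have v8: "(vector [a, b, c, d, e, f, g, h] :: complex ^ 8) $ 0 = h" for a b c d e f g h
    unfolding 8 [symmetric] by (rule vector_8)
  note defs = Mtilde_minus_def Mtilde_plus_def matrix_matrix_mult_def sum_4 Mminus_def Mplus_def
     Q_def Let_def W_def r_def e_def e'_def a_def om_def [symmetric]
  show "Mtilde_minus l \<alpha> (Q \<alpha>) $ 1 $ q = a ^ 3 * e' * (om q - r * om q ^ 2 + om q ^ 3)"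
    "Mtilde_minus l \<alpha> (Q \<alpha>) $ 2 $ q = a ^ 3 * e' * (r - om q + om q ^ 3)"
    by (simp_all add: defs v8,
        simp_all add: algebra_simps power_mult_distrib power2_eq_square power3_eq_cube)
  show "Mtilde_minus l \<alpha> (Q \<alpha>) $ 3 $ q = 0" "Mtilde_minus l \<alpha> (Q \<alpha>) $ 4 $ q = 0"
    "Mtilde_plus l \<alpha> (Q \<alpha>) $ 1 $ q = 0" "Mtilde_plus l \<alpha> (Q \<alpha>) $ 2 $ q = 0"
    by (simp_all add: defs v8)
  show "Mtilde_plus l \<alpha> (Q \<alpha>) $ 3 $ q = a ^ 3 * e * (om q + r * om q ^ 2 + om q ^ 3)"
    "Mtilde_plus l \<alpha> (Q \<alpha>) $ 4 $ q = a ^ 3 * e * (- r - om q + om q ^ 3)"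
    by (simp_all add: defs v8,
        simp_all add: algebra_simps power_mult_distrib power2_eq_square power3_eq_cube)
qed

text \<open>\<open>Mtilde_minus\<close> lives in rows 1, 2 and columns 2, 3, and
  \<open>Mtilde_plus\<close> in rows 3, 4 and columns 1, 4. Hence the diagonal projection selects
  the second summand, and invertibility reduces to two 2 x 2 blocks.\<close>

lemma Mtilde_Q:
  assumes \<alpha>: "\<alpha> > 0"
  shows "invertible (Mtilde l \<alpha> (Q \<alpha>))"
    and "Mtilde l \<alpha> (Q \<alpha>) ** diag (vector [1, 0, 0, 1]) = Mtilde_plus l \<alpha> (Q \<alpha>)"
proof -
  define r where "r = complex_of_real (sqrt 2)"
  define a where "a = complex_of_real \<alpha>"
  have ra: "r \<noteq> 0" "a \<noteq> 0" using \<alpha> by (simp_all add: r_def a_def)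
  note E = Mtilde_Q_entries [where l = l and \<alpha> = \<alpha>, folded r_def a_def]
    and om = om_quadratic [folded r_def]
  show "invertible (Mtilde l \<alpha> (Q \<alpha>))"
    unfolding invertible_det_nz
  proof
    assume "det (Mtilde l \<alpha> (Q \<alpha>)) = 0"
    then obtain c where c: "c \<noteq> 0" "Mtilde l \<alpha> (Q \<alpha>) *v c = 0"
      by (auto simp: det_eq_0_iff_kernel)
    \<comment> \<open>Absorbing the nonzero exponentials into \<open>c\<close> leaves each block as
      a sum and a difference of two unknowns.\<close>
    define b where "b = (\<lambda>q. exp (om q * a * of_real l) * c $ q)"
    define b' where "b' = (\<lambda>q. exp (- (om q * a * of_real l)) * c $ q)"
    have row: "(\<Sum>q\<in>UNIV. (Mtilde_minus l \<alpha> (Q \<alpha>) $ p $ q + Mtilde_plus l \<alpha> (Q \<alpha>) $ p $ q) *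
        c $ q) = 0" for p
      using c(2) by (simp add: vec_eq_iff matrix_vector_mult_def Mtilde_def)
    have "2 * \<i> * r * a ^ 3 * (b' 2 - b' 3) = 0" "2 * r * a ^ 3 * (b' 2 + b' 3) = 0"
      "2 * \<i> * r * a ^ 3 * (b 1 - b 4) = 0" "- 2 * r * a ^ 3 * (b 1 + b 4) = 0"
      using row [of 1] row [of 2] row [of 3] row [of 4]
      by (simp_all only: E om sum_4 b_def b'_def mult_zero_right mult_zero_left add_0_left add_0_right
         flip: add.assoc) (simp_all add: algebra_simps)
    then have "b' 2 = b' 3" "b' 2 + b' 3 = 0" "b 1 = b 4" "b 1 + b 4 = 0"
      using ra by simp_all
    then have "b' 2 = 0" "b' 3 = 0" "b 1 = 0" "b 4 = 0"
      by (simp_all flip: mult_2)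
    then have "c = 0"
      by (simp add: b_def b'_def vec_eq_iff forall_4)
    with c show False by simp
  qed
  show "Mtilde l \<alpha> (Q \<alpha>) ** diag (vector [1, 0, 0, 1]) = Mtilde_plus l \<alpha> (Q \<alpha>)"
    by (simp add: vec_eq_iff forall_4 matrix_matrix_mult_def sum_4 Mtilde_def diag_def E om)
qed

lemma matrix_inv_mult_cancel:
  fixes A :: "'a::semiring_1 ^ 'n ^ 'n"
  assumes "invertible A"
  shows "matrix_inv A ** (A ** B) = B" "A ** (matrix_inv A ** B) = B"
  by (simp_all add: matrix_mul_assoc matrix_inv_invertible [OF assms])

text \<open>\<open>Lsq\<close> is the cyclic index shift by two, so the product pairs each root with
  its negative.\<close>

lemma Omega_Lsq_entries: "(Omega ** Lsq) $ i $ j = (if j = i + 2 then om i else 0)"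
proof -
  have *: "(5::4) = 1" "(6::4) = 2" by simp_all
  show ?thesis
    using exhaust_4 [of i] exhaust_4 [of j]
    by (elim disjE) (simp_all add: matrix_matrix_mult_def sum_4 Omega_def Lsq_def diag_def om_def *)
qed

lemma invertible_Omega_Lsq: "invertible (Omega ** Lsq)"
proof -
  have "Omega ** diag (\<chi> i. inverse (om i)) = mat 1"
    by (simp add: vec_eq_iff forall_4 matrix_matrix_mult_def sum_4 Omega_def diag_def mat_def
        om_def [where q = 1, simplified, symmetric] om_def [where q = 2, simplified, symmetric]
        om_def [where q = 3, simplified, symmetric] om_def [where q = 4, simplified, symmetric])
  moreover have "Lsq ** Lsq = mat 1"
    by (simp add: vec_eq_iff forall_4 matrix_matrix_mult_def sum_4 Lsq_def mat_def)
  ultimately have "invertible Omega" "invertible Lsq"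
    by (auto simp: invertible_right_inverse)
  then show ?thesis
    by (rule invertible_mult)
qed

lemma Gplus_Q:
  assumes \<alpha>: "\<alpha> > 0"
  shows "Gplus l \<alpha> (Q \<alpha>) = diag (vector [1, 0, 0, 1]) ** (Omega ** Lsq)"
  using matrix_inv_mult_cancel(1) [OF Mtilde_Q(1) [OF \<alpha>], of l "diag (vector [1, 0, 0, 1])"]
  unfolding Gplus_def Mtilde_Q(2) [OF \<alpha>] by (simp flip: matrix_mul_assoc)

subsection \<open>The boundary matrix\<close>

text \<open>The solution \<open>Wlam c\<close> satisfies the boundary conditions iff \<open>c\<close> is in the kernel of this matrix.\<close>

definition boundary_matrix :: "real \<Rightarrow> real \<Rightarrow> real \<Rightarrow> complex ^ 8 ^ 4 \<Rightarrow> complex \<Rightarrow> complex ^ 4 ^ 4" where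
  "boundary_matrix l \<alpha> k M lam = Mminus M ** Wlam \<alpha> k lam (-l) + Mplus M ** Wlam \<alpha> k lam l"

text \<open>At the two ends \<open>Wlam\<close> is \<open>W A\<close> and \<open>W B\<close>, so the
  boundary matrix is \<open>Mtilde_minus A + Mtilde_plus B\<close>; replacing
  \<open>Mtilde_minus\<close> by \<open>Mtilde - Mtilde_plus\<close> lets \<open>Mtilde\<close> be
  pulled out.\<close>

lemma boundary_matrix_factor:
  fixes l \<alpha> k :: real and lam :: complex
  defines "A \<equiv> matrix_inv (W \<alpha> (-l)) ** Wlam \<alpha> k lam (-l)"
    and "B \<equiv> matrix_inv (W \<alpha> l) ** Wlam \<alpha> k lam l"
  assumes \<alpha>: "\<alpha> > 0" and M: "invertible (Mtilde l \<alpha> M)"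
    and P: "P = matrix_inv (Mtilde l \<alpha> M) ** Mtilde_plus l \<alpha> M"
  shows "boundary_matrix l \<alpha> k M lam = Mtilde l \<alpha> M ** (A + P ** (B - A))"
proof -
  have W: "W \<alpha> x ** (matrix_inv (W \<alpha> x) ** C) = C" for x C
    by (rule matrix_inv_mult_cancel) (rule fundamental_inverse(3) [OF fundamental_W [OF \<alpha>]])
  have "Mtilde l \<alpha> M ** (A + P ** (B - A)) = Mtilde l \<alpha> M ** A + Mtilde_plus l \<alpha> M ** (B - A)"
    unfolding P matrix_add_ldistrib
    by (simp add: matrix_inv_mult_cancel [OF M] flip: matrix_mul_assoc)
  also have "\<dots> = Mtilde_minus l \<alpha> M ** A + Mtilde_plus l \<alpha> M ** B"
    by (simp add: Mtilde_def matrix_add_rdistrib matrix_diff_distrib)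
  also have "\<dots> = boundary_matrix l \<alpha> k M lam"
    unfolding Mtilde_minus_def Mtilde_plus_def A_def B_def boundary_matrix_def
    by (simp add: W flip: matrix_mul_assoc)
  finally show ?thesis ..
qed

text \<open>The two diagonal projections add up to the identity and differ by \<open>Emat\<close>;
  passing from \<open>l\<close> to \<open>-l\<close> swaps \<open>A\<close> and
  \<open>B\<close>.\<close>

lemma X_eqs:
  fixes l \<alpha> k :: real and lam :: complex
  defines "A \<equiv> matrix_inv (W \<alpha> (-l)) ** Wlam \<alpha> k lam (-l)"
    and "B \<equiv> matrix_inv (W \<alpha> l) ** Wlam \<alpha> k lam l"
  shows "X \<alpha> k lam l = A + diag (vector [1, 0, 0, 1]) ** (B - A)"
    and "X \<alpha> k lam l - X \<alpha> k lam (-l) = Emat ** (B - A)"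
proof -
  have X: "X \<alpha> k lam l = diag (vector [0, 1, 1, 0]) ** A + diag (vector [1, 0, 0, 1]) ** B"
    "X \<alpha> k lam (-l) = diag (vector [0, 1, 1, 0]) ** B + diag (vector [1, 0, 0, 1]) ** A"
    by (simp_all add: X_def A_def B_def matrix_mul_assoc)
  have "diag (vector [0, 1, 1, 0]) + diag (vector [1, 0, 0, 1]) = mat 1"
    and E: "diag (vector [1, 0, 0, 1]) - diag (vector [0, 1, 1, 0]) = Emat"
    by (simp_all add: vec_eq_iff forall_4 diag_def mat_def Emat_def)
  then have "diag (vector [0, 1, 1, 0]) ** A = A - diag (vector [1, 0, 0, 1]) ** A"
    by (metis add_diff_cancel_right' matrix_add_rdistrib matrix_mul_lid)
  then show "X \<alpha> k lam l = A + diag (vector [1, 0, 0, 1]) ** (B - A)"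
    unfolding X by (simp add: matrix_diff_distrib)
  show "X \<alpha> k lam l - X \<alpha> k lam (-l) = Emat ** (B - A)"
    unfolding X E [symmetric] by (simp add: matrix_diff_distrib)
qed

text \<open>In \<open>Gmat\<close> the factor \<open>Omega ** Lsq\<close> cancels, leaving
  \<open>(P - ?D) ** Emat\<close>, and this \<open>Emat\<close> cancels against the one in
  \<open>X l - X (-l)\<close>. What remains is the second factor of the boundary matrix, whose first
  factor is invertible.\<close>

lemma det_boundary_matrix_eq_0_iff:
  assumes \<alpha>: "\<alpha> > 0" and M: "invertible (Mtilde l \<alpha> M)"
  shows "det (boundary_matrix l \<alpha> k M lam) = 0 \<longleftrightarrow>
    det (Gmat l \<alpha> M ** (X \<alpha> k lam l - X \<alpha> k lam (-l)) + X \<alpha> k lam l) = 0"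
proof -
  let ?A = "matrix_inv (W \<alpha> (-l)) ** Wlam \<alpha> k lam (-l)"
  let ?B = "matrix_inv (W \<alpha> l) ** Wlam \<alpha> k lam l"
  let ?D = "diag (vector [1, 0, 0, 1])"
  define P where "P = matrix_inv (Mtilde l \<alpha> M) ** Mtilde_plus l \<alpha> M"
  have "Gplus l \<alpha> M = P ** (Omega ** Lsq)"
    by (simp add: Gplus_def P_def matrix_mul_assoc)
  then have "Gmat l \<alpha> M = (P - ?D) ** Emat"
    unfolding Gmat_def Gplus_Q [OF \<alpha>]
    by (simp add: matrix_inv_invertible(1) [OF invertible_Omega_Lsq]
        matrix_mul_assoc [of _ "Omega ** Lsq", symmetric]
        matrix_mul_assoc [of "Omega ** Lsq"] flip: matrix_diff_distrib(1))
  moreover have "Emat ** Emat = mat 1"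
    by (simp add: vec_eq_iff forall_4 matrix_matrix_mult_def sum_4 Emat_def diag_def mat_def)
  ultimately have "Gmat l \<alpha> M ** (X \<alpha> k lam l - X \<alpha> k lam (-l)) = (P - ?D) ** (?B - ?A)"
    unfolding X_eqs(2) by (metis matrix_mul_assoc matrix_mul_lid)
  then have "Gmat l \<alpha> M ** (X \<alpha> k lam l - X \<alpha> k lam (-l)) + X \<alpha> k lam l = ?A + P ** (?B - ?A)"
    unfolding X_eqs(1) by (simp add: matrix_diff_distrib)
  then show ?thesis
    using M boundary_matrix_factor [OF \<alpha> M P_def] by (simp add: det_mul invertible_det_nz)
qed

lemma det_boundary_matrix_Q_eq_0_iff:
  assumes \<alpha>: "\<alpha> > 0"
  shows "det (boundary_matrix l \<alpha> k (Q \<alpha>) lam) = 0 \<longleftrightarrow> det (X \<alpha> k lam l) = 0"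
proof -
  have "Gmat l \<alpha> (Q \<alpha>) = 0"
    by (simp add: Gmat_def vec_eq_iff matrix_matrix_mult_def)
  then have "Gmat l \<alpha> (Q \<alpha>) ** Y = 0" for Y :: "complex ^ 4 ^ 4"
    by (simp add: vec_eq_iff matrix_matrix_mult_def)
  then show ?thesis
    using det_boundary_matrix_eq_0_iff [OF \<alpha> Mtilde_Q(1) [OF \<alpha>]] by simp
qed

subsection \<open>Measure-theoretic preliminaries\<close>

text \<open>Passes from almost-everywhere statements to negligible sets, the form suited to the
  gauge integral.\<close>

lemma AE_lebesgue_on_iff:
  fixes S :: "'a::euclidean_space set"
  assumes "S \<in> sets lebesgue"
  shows "(AE x in lebesgue_on S. P x) \<longleftrightarrow> (\<exists>N. negligible N \<and> (\<forall>x\<in>S - N. P x))"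
proof
  assume "AE x in lebesgue_on S. P x"
  then have "AE x in lebesgue. x \<in> S \<longrightarrow> P x"
    using assms by (simp add: AE_restrict_space_iff)
  then obtain N where "{x \<in> space lebesgue. \<not> (x \<in> S \<longrightarrow> P x)} \<subseteq> N"
    "emeasure lebesgue N = 0" "N \<in> sets lebesgue"
    by (rule AE_E)
  then show "\<exists>N. negligible N \<and> (\<forall>x\<in>S - N. P x)"
    by (intro exI [of _ N]) (auto simp add: negligible_iff_null_sets intro!: null_setsI)
next
  assume "\<exists>N. negligible N \<and> (\<forall>x\<in>S - N. P x)"
  then have "AE x in lebesgue. x \<in> S \<longrightarrow> P x"
    by (auto simp: negligible_iff_null_sets intro!: AE_I')
  then show "AE x in lebesgue_on S. P x"
    using assms by (simp add: AE_restrict_space_iff)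
qed

text \<open>A nonzero value would persist on a nondegenerate subinterval, which is not
  negligible.\<close>

lemma continuous_on_zero_off_negligible:
  fixes f :: "real \<Rightarrow> 'a::real_normed_vector"
  assumes f: "continuous_on {a..b} f" and ab: "a < b" and N: "negligible N"
    and 0: "\<And>x. x \<in> {a..b} - N \<Longrightarrow> f x = 0" and x: "x \<in> {a..b}"
  shows "f x = 0"
proof (rule ccontr)
  assume "f x \<noteq> 0"
  with f x obtain e where e: "e > 0" "\<And>y. y \<in> {a..b} \<Longrightarrow> dist y x < e \<Longrightarrow> dist (f y) (f x) < norm (f x)"
    unfolding continuous_on_iff by (metis zero_less_norm_iff)
  define c d where "c = max a (x - e / 2)" and "d = min b (x + e / 2)"
  have "c < d" using ab x e(1) by (auto simp: c_def d_def)
  have "cbox c d \<subseteq> N"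
  proof
    fix y assume "y \<in> cbox c d"
    then have "y \<in> {a..b}" "dist y x < e"
      using e(1) by (auto simp: c_def d_def dist_real_def)
    with e(2) [of y] 0 [of y] show "y \<in> N"
      by (cases "y \<in> N") (auto simp: dist_norm)
  qed
  then have "negligible (cbox c d)"
    using N negligible_subset by blast
  with \<open>c < d\<close> show False
    using negligible_interval(1) [of c d] by simp
qed

text \<open>A one-sided form of Lebesgue's differentiation theorem.\<close>

lemma indefinite_integral_right_derivative_ae:
  fixes g :: "real \<Rightarrow> 'a::euclidean_space"
  assumes g: "g integrable_on {a..b}"
  obtains N where "negligible N"
    "\<And>x. x \<in> {a..<b} - N \<Longrightarrow>
       ((\<lambda>u. integral {a..u} g) has_vector_derivative g x) (at x within {x..b})"
proof -
  \<comment> \<open>Extension by zero, because the differentiation theorem applied below concerns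
    functions on the whole space. Its averages run over intervals starting at \<open>x\<close>,
    hence the right derivative.\<close>
  define f where "f = (\<lambda>x. if x \<in> {a..b} then g x else 0)"
  have "f integrable_on UNIV"
    unfolding f_def using g by (simp only: integrable_restrict_UNIV)
  then have "f integrable_on cbox c d" for c d
    using integrable_on_subcbox by blast
  then obtain N where N: "negligible N" and f: "\<And>x e. \<lbrakk>x \<notin> N; 0 < e\<rbrakk> \<Longrightarrow> \<exists>d>0. \<forall>h. 0 < h \<and> h < d \<longrightarrow>
       norm (integral (cbox x (x + h *\<^sub>R One)) f /\<^sub>R h ^ DIM(real) - f x) < e"
    using integrable_ccontinuous_explicit [of f] by blast
  show ?thesis
  proof
    show "negligible N" by (rule N)
    fix x assume x: "x \<in> {a..<b} - N"
    show "((\<lambda>u. integral {a..u} g) has_vector_derivative g x) (at x within {x..b})"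
      unfolding has_vector_derivative_def has_derivative_within_alt
    proof (intro conjI allI impI)
      show "bounded_linear (\<lambda>h. h *\<^sub>R g x)"
        by (rule bounded_linear_scaleR_left)
      fix e :: real assume "e > 0"
      with f [of x e] x obtain d where d: "d > 0"
        "\<And>h. 0 < h \<Longrightarrow> h < d \<Longrightarrow> norm (integral {x..x + h} f /\<^sub>R h - f x) < e"
        by auto
      have "norm (integral {a..y} g - integral {a..x} g - (y - x) *\<^sub>R g x) \<le> e * norm (y - x)"
        if y: "y \<in> {x..b}" "norm (y - x) < d" for y
      proof (cases "y = x")
        case False
        define h where "h = y - x"
        have h: "0 < h" "h < d" "y = x + h" using False y by (auto simp: h_def)
        have "integral {a..x} g + integral {x..y} g = integral {a..y} g"
          by (rule Henstock_Kurzweil_Integration.integral_combine)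
            (use x y in \<open>auto intro: integrable_subinterval_real [OF g]\<close>)
        moreover have "integral {x..y} f = integral {x..y} g"
          by (rule integral_cong) (use x y in \<open>auto simp: f_def\<close>)
        ultimately have *: "integral {a..y} g - integral {a..x} g = integral {x..x + h} f"
          by (simp add: h(3) algebra_simps)
        have "f x = g x" using x by (auto simp: f_def)
        then have "integral {x..x + h} f - h *\<^sub>R g x = h *\<^sub>R (integral {x..x + h} f /\<^sub>R h - f x)"
          using h by (simp add: scaleR_diff_right)
        then have "norm (integral {x..x + h} f - h *\<^sub>R g x) = h * norm (integral {x..x + h} f /\<^sub>R h - f x)"
          using h by simp
        also have "\<dots> \<le> h * e"
          using d(2) [OF h(1,2)] h(1) by simp
        finally show ?thesis
          unfolding * using h by (simp add: mult.commute)
      qed simp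
      with \<open>d > 0\<close> show "\<exists>d>0. \<forall>y\<in>{x..b}. norm (y - x) < d \<longrightarrow>
         norm (integral {a..y} g - integral {a..x} g - (y - x) *\<^sub>R g x) \<le> e * norm (y - x)"
        by blast
    qed
  qed
qed

lemma integrable_continuous_mult:
  fixes f w :: "real \<Rightarrow> complex"
  assumes f: "continuous_on {a..b} f" and w: "integrable (lebesgue_on {a..b}) w"
  shows "integrable (lebesgue_on {a..b}) (\<lambda>x. f x * w x)"
proof -
  obtain B where "\<forall>y\<in>f ` {a..b}. norm y \<le> B"
    using compact_imp_bounded [OF compact_continuous_image [OF f]] by (auto simp: bounded_iff)
  then have B: "norm (f x) \<le> B" if "x \<in> {a..b}" for x
    using that by blast
  have f': "f \<in> borel_measurable (lebesgue_on {a..b})"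
    using f by (intro continuous_imp_measurable_on_sets_lebesgue) auto
  show ?thesis
  proof (rule Bochner_Integration.integrable_bound)
    show "integrable (lebesgue_on {a..b}) (\<lambda>x. B * norm (w x))"
      using w by simp
    show "(\<lambda>x. f x * w x) \<in> borel_measurable (lebesgue_on {a..b})"
      using f' w by simp
    have "norm (f x * w x) \<le> norm (B * norm (w x))" if "x \<in> {a..b}" for x
      using mult_right_mono [OF B [OF that] norm_ge_zero [of "w x"]]
      by (metis abs_ge_self norm_mult order_trans real_norm_def)
    then show "AE x in lebesgue_on {a..b}. norm (f x * w x) \<le> norm (B * norm (w x))"
      by (intro AE_I2) simp
  qed
qed

text \<open>Domination by t \<le> 1 + t^2, as constants are integrable on a bounded
  interval.\<close>

lemma L2_integrable: "w \<in> L2 l \<Longrightarrow> integrable (lebesgue_on {-l..l}) w"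
proof -
  assume w: "w \<in> L2 l"
  show ?thesis
  proof (rule Bochner_Integration.integrable_bound)
    have "integrable (lebesgue_on {-l..l}) (\<lambda>_. 1 :: real)"
      by (intro continuous_imp_integrable_real continuous_intros)
    then show "integrable (lebesgue_on {-l..l}) (\<lambda>x. 1 + (cmod (w x))\<^sup>2)"
      using w by (simp add: L2_def)
    show "w \<in> borel_measurable (lebesgue_on {-l..l})"
      using w by (simp add: L2_def)
    have "t \<le> 1 + t\<^sup>2" for t :: real
      using sum_squares_bound [of t 1] zero_le_power2 [of t] by (simp only: power_one mult_1_right)
    then show "AE x in lebesgue_on {-l..l}. norm (w x) \<le> norm (1 + (cmod (w x))\<^sup>2)"
      by (intro AE_I2) (auto intro: order_trans)
  qed
qed

lemma continuous_in_L2: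
  assumes "continuous_on {-l..l} v"
  shows "v \<in> L2 l"
proof -
  have "integrable (lebesgue_on {-l..l}) (\<lambda>x. (cmod (v x))\<^sup>2)"
    using assms by (intro continuous_imp_integrable_real continuous_intros)
  moreover have "v \<in> borel_measurable (lebesgue_on {-l..l})"
    using assms by (intro continuous_imp_measurable_on_sets_lebesgue) auto
  ultimately show ?thesis by (simp add: L2_def)
qed

subsection \<open>The integral operator\<close>

lemma yvec_eq: "yvec \<alpha> x $ j = exp (om j * of_real \<alpha> * of_real x)"
  by (simp add: yvec_def om_def)

lemma yvec_continuous_on: "continuous_on S (\<lambda>x. yvec \<alpha> x $ j)"
  unfolding yvec_eq by (intro continuous_intros)

text \<open>Assuming invertibility instead of well-posedness lets \<open>Mtilde_Q\<close> supply the
  instance for \<open>Q\<close>.\<close>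

locale Green_kernel =
  fixes l \<alpha> k :: real and M :: "complex ^ 8 ^ 4"
  assumes l: "l > 0" and \<alpha>: "\<alpha> > 0" and k: "k > 0" and M: "invertible (Mtilde l \<alpha> M)"
begin

definition moments :: "(real \<Rightarrow> complex) \<Rightarrow> real \<Rightarrow> complex ^ 4" where
  "moments w x = (\<chi> j. integral {-l..x} (\<lambda>\<xi>. yvec \<alpha> \<xi> $ j * w \<xi>))"

text \<open>The function \<open>f\<close> of the overview.\<close>

definition coeffs :: "(real \<Rightarrow> complex) \<Rightarrow> real \<Rightarrow> complex ^ 4" where
  "coeffs w x = of_real (\<alpha> / (4 * k)) *s (Gplus l \<alpha> M *v moments w l - (Omega ** Lsq) *v moments w x)"

text \<open>The vector of \<open>Kop w\<close> and its first three derivatives, by variation of constants.\<close>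

definition Kvec :: "(real \<Rightarrow> complex) \<Rightarrow> real \<Rightarrow> complex ^ 4" where
  "Kvec w x = W \<alpha> x *v coeffs w x"

lemma Gplus_Gminus: "Gplus l \<alpha> M + Gminus l \<alpha> M = Omega ** Lsq"
proof -
  have "Gplus l \<alpha> M + Gminus l \<alpha> M = matrix_inv (Mtilde l \<alpha> M) ** Mtilde l \<alpha> M ** Omega ** Lsq"
    unfolding Gplus_def Gminus_def Mtilde_def
    by (simp add: matrix_add_rdistrib matrix_add_ldistrib add.commute)
  then show ?thesis
    by (simp add: matrix_inv_invertible(2) [OF M])
qed

lemma integrable_yvec_mult:
  "integrable (lebesgue_on {-l..l}) w \<Longrightarrow> integrable (lebesgue_on {-l..l}) (\<lambda>\<xi>. yvec \<alpha> \<xi> $ j * w \<xi>)"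
  by (intro integrable_continuous_mult yvec_continuous_on)

lemma integrable_on_yvec_mult:
  "integrable (lebesgue_on {-l..l}) w \<Longrightarrow> (\<lambda>\<xi>. yvec \<alpha> \<xi> $ j * w \<xi>) integrable_on {-l..l}"
  by (intro integrable_on_lebesgue_on integrable_yvec_mult) auto

text \<open>By \<open>Gplus_Gminus\<close> the lower branch is the upper one minus a term free of
  \<open>M\<close>. The kernel thus splits into a separable part and a Volterra part.\<close>

lemma Green_eq:
  "Green l \<alpha> k M x \<xi> = of_real (\<alpha> / (4 * k)) *
     (scalar_product (yvec \<alpha> x) (Gplus l \<alpha> M *v yvec \<alpha> \<xi>)
      - indicator {..<x} \<xi> * scalar_product (yvec \<alpha> x) ((Omega ** Lsq) *v yvec \<alpha> \<xi>))"
proof -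
  have "scalar_product (yvec \<alpha> x) ((Omega ** Lsq) *v yvec \<alpha> \<xi>) =
    scalar_product (yvec \<alpha> x) (Gplus l \<alpha> M *v yvec \<alpha> \<xi>) +
    scalar_product (yvec \<alpha> x) (Gminus l \<alpha> M *v yvec \<alpha> \<xi>)"
    unfolding Gplus_Gminus [symmetric] matrix_vector_mult_add_rdistrib
    by (simp add: scalar_product_def sum.distrib distrib_left)
  then show ?thesis
    by (simp add: Green_def indicator_def)
qed

lemma moments_truncated:
  assumes w: "integrable (lebesgue_on {-l..l}) w" and x: "x \<in> {-l..l}"
  shows "(LINT \<xi>|lebesgue_on {-l..l}. indicator {..<x} \<xi> *\<^sub>R (yvec \<alpha> \<xi> $ j * w \<xi>)) = moments w x $ j"
    and "integrable (lebesgue_on {-l..l}) (\<lambda>\<xi>. indicator {..<x} \<xi> *\<^sub>R (yvec \<alpha> \<xi> $ j * w \<xi>))"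
proof -
  let ?g = "\<lambda>\<xi>. yvec \<alpha> \<xi> $ j * w \<xi>"
  have "integrable (lebesgue_on {-l..l}) (\<lambda>\<xi>. indicator {-l..<x} \<xi> *\<^sub>R ?g \<xi>)"
    using x by (intro integrable_mult_indicator integrable_yvec_mult w) (auto simp: sets_restrict_space_iff)
  then show int: "integrable (lebesgue_on {-l..l}) (\<lambda>\<xi>. indicator {..<x} \<xi> *\<^sub>R ?g \<xi>)"
    by (rule Bochner_Integration.integrable_cong [THEN iffD1, rotated 2]) (auto simp: indicator_def)
  have "(LINT \<xi>|lebesgue_on {-l..l}. indicator {..<x} \<xi> *\<^sub>R ?g \<xi>) =
      integral {-l..l} (\<lambda>\<xi>. indicator {..<x} \<xi> *\<^sub>R ?g \<xi>)"
    using int by (intro lebesgue_integral_eq_integral) auto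
  also have "\<dots> = integral {-l..l} (\<lambda>\<xi>. if \<xi> \<in> {-l..x} then ?g \<xi> else 0)"
    \<comment> \<open>The half-open and the closed range differ only in the point
      \<open>x\<close>.\<close>
    by (rule integral_spike [of "{x}"]) (auto simp: indicator_def)
  also have "\<dots> = integral {-l..x} ?g"
  proof -
    have "{-l..x} \<subseteq> {-l..l}" using x by auto
    then show ?thesis
      by (simp only: integral_def integrable_on_def has_integral_restrict)
  qed
  finally show "(LINT \<xi>|lebesgue_on {-l..l}. indicator {..<x} \<xi> *\<^sub>R ?g \<xi>) = moments w x $ j"
    by (simp add: moments_def)
qed

lemma Kop_eq_Kvec:
  assumes w: "integrable (lebesgue_on {-l..l}) w" and x: "x \<in> {-l..l}"
  shows "Kop l \<alpha> k M w x = Kvec w x $ 1"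
proof -
  define g where "g = (\<lambda>j \<xi>. yvec \<alpha> \<xi> $ j * w \<xi>)"
  \<comment> \<open>The scaled row vector \<open>yvec \<alpha> x\<close> times \<open>A\<close>; it
    is constant in \<open>\<xi>\<close> and can be taken out of the integral.\<close>
  define p where "p = (\<lambda>(A :: complex ^ 4 ^ 4) j. of_real (\<alpha> / (4 * k)) * (\<Sum>i\<in>UNIV. yvec \<alpha> x $ i * A $ i $ j))"
  have sp: "of_real (\<alpha> / (4 * k)) * scalar_product (yvec \<alpha> x) (A *v v) = (\<Sum>j\<in>UNIV. p A j * v $ j)" for A v
    unfolding scalar_product_def matrix_vector_mult_def p_def vec_lambda_beta sum_distrib_left sum_distrib_right
    by (subst sum.swap) (simp add: mult_ac)
  define h where "h = (\<lambda>j \<xi>. indicator {..<x} \<xi> *\<^sub>R g j \<xi>)"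
  have Gr: "Green l \<alpha> k M x \<xi> * w \<xi> = (\<Sum>j\<in>UNIV. p (Gplus l \<alpha> M) j * g j \<xi>)
      - (\<Sum>j\<in>UNIV. p (Omega ** Lsq) j * h j \<xi>)" for \<xi>
  proof -
    have "Green l \<alpha> k M x \<xi> = (\<Sum>j\<in>UNIV. p (Gplus l \<alpha> M) j * yvec \<alpha> \<xi> $ j)
      - indicator {..<x} \<xi> * (\<Sum>j\<in>UNIV. p (Omega ** Lsq) j * yvec \<alpha> \<xi> $ j)"
      unfolding Green_eq sp [symmetric] by (simp add: right_diff_distrib mult.left_commute)
    then show ?thesis
      by (cases "\<xi> < x") (simp_all add: g_def h_def left_diff_distrib sum_distrib_right mult.assoc)
  qed
  have 1: "integrable (lebesgue_on {-l..l}) (g j)" for j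
    unfolding g_def by (rule integrable_yvec_mult [OF w])
  have 2: "(LINT \<xi>|lebesgue_on {-l..l}. h j \<xi>) = moments w x $ j" "integrable (lebesgue_on {-l..l}) (h j)" for j
    unfolding h_def g_def by (rule moments_truncated [OF w x])+
  have 3: "(LINT \<xi>|lebesgue_on {-l..l}. g j \<xi>) = moments w l $ j" for j
    using 1 unfolding moments_def vec_lambda_beta g_def
    by (intro lebesgue_integral_eq_integral) auto
  have "Kop l \<alpha> k M w x = (\<Sum>j\<in>UNIV. p (Gplus l \<alpha> M) j * moments w l $ j)
      - (\<Sum>j\<in>UNIV. p (Omega ** Lsq) j * moments w x $ j)"
    unfolding Kop_def Gr using 1 2 by (simp add: 3)
  also have "\<dots> = of_real (\<alpha> / (4 * k)) * scalar_product (yvec \<alpha> x)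
      (Gplus l \<alpha> M *v moments w l - (Omega ** Lsq) *v moments w x)"
    by (simp add: scalar_product_def right_diff_distrib sum_subtractf flip: sp)
  \<comment> \<open>The first row of \<open>W \<alpha> x\<close> is
    \<open>yvec \<alpha> x\<close>.\<close>
  also have "\<dots> = Kvec w x $ 1"
    unfolding Kvec_def coeffs_def vec.scale matrix_vector_mult_def [of "W \<alpha> x"] scalar_product_def
    by (simp add: W_def yvec_def sum_distrib_left mult_ac del: of_real_divide)
  finally show ?thesis .
qed

lemma moments_continuous_on:
  "integrable (lebesgue_on {-l..l}) w \<Longrightarrow> continuous_on {-l..l} (\<lambda>x. moments w x $ j)"
  unfolding moments_def vec_lambda_beta
  by (intro indefinite_integral_continuous_1 integrable_on_yvec_mult)

lemma W_entry_has_vector_derivative: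
  "((\<lambda>t. W \<alpha> t $ p $ i) has_vector_derivative
      companion (- of_real (\<alpha> ^ 4)) (column i (W \<alpha> x)) $ p) (at x within T)"
proof -
  have c: "W \<alpha> x *v axis i 1 = column i (W \<alpha> x)" for x
    by (simp add: vec_eq_iff matrix_vector_mult_axis column_def)
  show ?thesis
    using fundamental_solves [OF fundamental_W [OF \<alpha>], of UNIV "axis i 1", THEN solvesD, of x p]
    by (auto simp: c column_def intro: has_vector_derivative_at_within)
qed

lemma Kvec_continuous_on:
  assumes w: "integrable (lebesgue_on {-l..l}) w"
  shows "continuous_on {-l..l} (\<lambda>x. Kvec w x $ p)"
proof -
  have "continuous_on {-l..l} (\<lambda>t. W \<alpha> t $ p $ i)" for i
    unfolding continuous_on_eq_continuous_within
    using W_entry_has_vector_derivative has_vector_derivative_continuous by blast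
  moreover have "continuous_on {-l..l} (\<lambda>x. coeffs w x $ i)" for i
    unfolding coeffs_def matrix_vector_mult_def vector_minus_component vector_smult_component vec_lambda_beta
    by (intro continuous_on_mult continuous_on_diff continuous_on_sum continuous_on_const
        moments_continuous_on w)
  ultimately show ?thesis
    unfolding Kvec_def matrix_vector_mult_def vec_lambda_beta by (intro continuous_on_sum continuous_on_mult)
qed

text \<open>Product rule: differentiating \<open>W\<close> gives the companion term, differentiating
  \<open>coeffs\<close> the source term. The general \<open>T\<close> and \<open>z\<close> cover
  both right derivatives almost everywhere and derivatives on the whole interval for continuous
  data.\<close>

lemma Kvec_has_vector_derivative:
  assumes der: "\<And>j. ((\<lambda>t. moments w t $ j) has_vector_derivative yvec \<alpha> x $ j * z) (at x within T)"
  shows "((\<lambda>t. Kvec w t $ p) has_vector_derivative companion (- of_real (\<alpha> ^ 4)) (Kvec w x) $ p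
      + (if p = 4 then of_real (\<alpha> ^ 4 / k) * z else 0)) (at x within T)"
proof -
  define C where "C = complex_of_real (\<alpha> / (4 * k))"
  define E where "E = (\<lambda>i. exp (om i * of_real \<alpha> * of_real x))"
  let ?\<mu> = "- of_real (\<alpha> ^ 4) :: complex"
  have c: "((\<lambda>t. coeffs w t $ i) has_vector_derivative - C * om i * inverse (E i) * z) (at x within T)" for i
  proof -
    have "((\<lambda>t. C * ((Gplus l \<alpha> M *v moments w l) $ i - (\<Sum>j\<in>UNIV. (Omega ** Lsq) $ i $ j * moments w t $ j)))
      has_vector_derivative C * (0 - (\<Sum>j\<in>UNIV. (Omega ** Lsq) $ i $ j * (yvec \<alpha> x $ j * z)))) (at x within T)"
      by (intro has_vector_derivative_mult_right has_vector_derivative_diff has_vector_derivative_const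
          has_vector_derivative_sum der)
    \<comment> \<open>Only \<open>j = i + 2\<close> contributes, and there \<open>yvec\<close> is
      the reciprocal of \<open>E i\<close>.\<close>
    moreover have "(\<Sum>j\<in>UNIV. (Omega ** Lsq) $ i $ j * (yvec \<alpha> x $ j * z)) = om i * inverse (E i) * z"
      by (simp add: Omega_Lsq_entries yvec_eq om_shift E_def exp_minus if_distrib if_distribR cong: if_cong)
    moreover have "coeffs w t $ i = C * ((Gplus l \<alpha> M *v moments w l) $ i
        - (\<Sum>j\<in>UNIV. (Omega ** Lsq) $ i $ j * moments w t $ j))" for t
      by (simp only: coeffs_def matrix_vector_mult_def C_def vector_minus_component
          vector_smult_component vec_lambda_beta)
    ultimately show ?thesis
      by (simp add: mult.assoc)
  qed
  have "((\<lambda>t. \<Sum>i\<in>UNIV. W \<alpha> t $ p $ i * coeffs w t $ i) has_vector_derivative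
     (\<Sum>i\<in>UNIV. W \<alpha> x $ p $ i * (- C * om i * inverse (E i) * z) +
        companion ?\<mu> (column i (W \<alpha> x)) $ p * coeffs w x $ i)) (at x within T)"
    by (intro has_vector_derivative_sum has_vector_derivative_mult W_entry_has_vector_derivative c)
  moreover have "(\<Sum>i\<in>UNIV. companion ?\<mu> (column i (W \<alpha> x)) $ p * coeffs w x $ i) =
      companion ?\<mu> (Kvec w x) $ p"
    by (cases "p = 4") (simp_all add: companion_def Kvec_def matrix_vector_mult_def column_def
        sum_distrib_left mult.assoc sum_negf)
  moreover have "(\<Sum>i\<in>UNIV. W \<alpha> x $ p $ i * (- C * om i * inverse (E i) * z)) =
      (if p = 4 then of_real (\<alpha> ^ 4 / k) * z else 0)"
  proof -
    have "W \<alpha> x $ p $ i * (- C * om i * inverse (E i) * z) =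
        - C * of_real \<alpha> ^ (ix p - 1) * z * om i ^ ix p" for i
    proof -
      have "E i * inverse (E i) = 1" by (simp add: E_def)
      moreover have "om i ^ (ix p - 1) * om i = om i ^ ix p"
        using exhaust_4 [of p] by (elim disjE)
          (simp_all add: power2_eq_square power3_eq_cube power4_eq_xxxx)
      moreover have "W \<alpha> x $ p $ i = om i ^ (ix p - 1) * of_real \<alpha> ^ (ix p - 1) * E i"
        by (simp add: W_def E_def power_mult_distrib flip: om_def)
      moreover have "a * b * e * (- C * o' * e' * z) = - C * b * z * (a * o') * (e * e')"
        for a b e o' e' :: complex
        by (simp add: mult_ac)
      ultimately show ?thesis by (simp only: mult_1_right)
    qed
    then have "(\<Sum>i\<in>UNIV. W \<alpha> x $ p $ i * (- C * om i * inverse (E i) * z)) =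
        - C * of_real \<alpha> ^ (ix p - 1) * z * (\<Sum>i\<in>UNIV. om i ^ ix p)"
      by (simp only: sum_distrib_left)
    \<comment> \<open>The power sum is zero for \<open>p = 1, 2, 3\<close> and -4 for
      \<open>p = 4\<close>, which cancels the 4 in \<open>C\<close>.\<close>
    also have "\<dots> = (if p = 4 then of_real (\<alpha> ^ 4 / k) * z else 0)"
      using exhaust_4 [of p] k
      by (elim disjE) (simp_all add: sum_om_pow om_pow4 C_def,
        simp add: field_simps power3_eq_cube power4_eq_xxxx)
    finally show ?thesis .
  qed
  ultimately show ?thesis
    by (simp only: sum.distrib Kvec_def matrix_vector_mult_def vec_lambda_beta add.commute)
qed

text \<open>The moments vanish at \<open>-l\<close>, so \<open>coeffs\<close> is \<open>P b\<close>
  at \<open>-l\<close> and \<open>P b - b\<close> at \<open>l\<close>. The claim becomes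
  \<open>Mtilde P b = Mtilde_plus b\<close>, the defining property of \<open>P\<close>.\<close>

lemma Kvec_boundary: "Mminus M *v Kvec w (-l) + Mplus M *v Kvec w l = 0"
proof -
  define m where "m = of_real (\<alpha> / (4 * k)) *s moments w l"
  let ?P = "matrix_inv (Mtilde l \<alpha> M) ** Mtilde_plus l \<alpha> M"
  let ?b = "(Omega ** Lsq) *v m"
  have G: "Gplus l \<alpha> M = ?P ** (Omega ** Lsq)"
    by (simp add: Gplus_def matrix_mul_assoc)
  have "moments w (-l) = 0"
    by (simp add: moments_def vec_eq_iff)
  then have c: "coeffs w (-l) = ?P *v ?b" "coeffs w l = ?P *v ?b - ?b"
    by (simp_all add: coeffs_def G m_def vector_scalar_commute matrix_vector_mul_assoc vec.scale_right_diff_distrib)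
  have MP: "Mtilde l \<alpha> M ** ?P = Mtilde_plus l \<alpha> M"
    by (simp add: matrix_inv_mult_cancel [OF M])
  have "Mminus M *v Kvec w (-l) + Mplus M *v Kvec w l =
      Mtilde_minus l \<alpha> M *v coeffs w (-l) + Mtilde_plus l \<alpha> M *v coeffs w l"
    by (simp add: Kvec_def Mtilde_minus_def Mtilde_plus_def matrix_vector_mul_assoc)
  also have "\<dots> = (Mtilde l \<alpha> M ** ?P) *v ?b - Mtilde_plus l \<alpha> M *v ?b"
    unfolding c matrix_vector_mul_assoc [of _ ?P ?b, symmetric]
    by (subst Mtilde_def) (simp only: matrix_vector_mult_add_rdistrib matrix_vector_mult_diff_distrib
        add_diff_eq)
  also have "\<dots> = 0"
    unfolding MP by simp
  finally show ?thesis .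
qed

lemma moments_cong_negligible:
  assumes "negligible N" "\<And>x. x \<in> {-l..l} - N \<Longrightarrow> v x = w x" "x \<le> l"
  shows "moments v x = moments w x"
  unfolding moments_def vec_eq_iff vec_lambda_beta
  by (intro allI integral_spike [OF assms(1)]) (use assms(2,3) in auto)

lemma moments_has_vector_derivative:
  assumes "continuous_on {-l..l} v" "x \<in> {-l..l}"
  shows "((\<lambda>t. moments v t $ j) has_vector_derivative yvec \<alpha> x $ j * v x) (at x within {-l..l})"
  unfolding moments_def vec_lambda_beta
  using assms by (intro integral_has_vector_derivative continuous_intros yvec_continuous_on)

section \<open>Eigenvalues and the kernel of the boundary matrix\<close>

text \<open>Once a component of \<open>Kvec\<close> vanishes everywhere, its right derivative shows
  that the next one vanishes almost everywhere, hence everywhere by continuity. The fourth equation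
  then leaves only the multiple of \<open>w\<close>.\<close>

lemma Kop_injective:
  assumes w: "integrable (lebesgue_on {-l..l}) w"
    and 0: "AE x in lebesgue_on {-l..l}. Kop l \<alpha> k M w x = 0"
  shows "AE x in lebesgue_on {-l..l}. w x = 0"
proof -
  have ll: "-l < l" using l by simp
  obtain N where N: "negligible N" "\<And>x. x \<in> {-l..l} - N \<Longrightarrow> Kop l \<alpha> k M w x = 0"
    using 0 by (auto simp: AE_lebesgue_on_iff)
  have "\<exists>D. negligible D \<and> (\<forall>x\<in>{-l..<l} - D.
      ((\<lambda>t. moments w t $ j) has_vector_derivative yvec \<alpha> x $ j * w x) (at x within {x..l}))" for j
    unfolding moments_def vec_lambda_beta
    by (rule indefinite_integral_right_derivative_ae [OF integrable_on_yvec_mult [OF w]]) blast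
  then obtain D where D: "\<And>j. negligible (D j)" "\<And>x j. x \<in> {-l..<l} - D j \<Longrightarrow>
      ((\<lambda>t. moments w t $ j) has_vector_derivative yvec \<alpha> x $ j * w x) (at x within {x..l})"
    by metis
  \<comment> \<open>At \<open>l\<close> there is no right derivative within the interval.\<close>
  define N' where "N' = insert l (\<Union>j. D j)"
  have N': "negligible N'"
    using D(1) by (auto simp: N'_def)
  note cont = Kvec_continuous_on [OF w]
  have step: "companion (- of_real (\<alpha> ^ 4)) (Kvec w x) $ p
      + (if p = 4 then of_real (\<alpha> ^ 4 / k) * w x else 0) = 0"
    if Z: "\<And>t. t \<in> {-l..l} \<Longrightarrow> Kvec w t $ p = 0" and x: "x \<in> {-l..l} - N'" for x p
  proof -
    have xl: "x < l" using x by (auto simp: N'_def)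
    have "((\<lambda>t. Kvec w t $ p) has_vector_derivative companion (- of_real (\<alpha> ^ 4)) (Kvec w x) $ p
      + (if p = 4 then of_real (\<alpha> ^ 4 / k) * w x else 0)) (at x within {x..l})"
      by (rule Kvec_has_vector_derivative, rule D(2)) (use x xl in \<open>auto simp: N'_def\<close>)
    then have "((\<lambda>t. 0) has_vector_derivative companion (- of_real (\<alpha> ^ 4)) (Kvec w x) $ p
      + (if p = 4 then of_real (\<alpha> ^ 4 / k) * w x else 0)) (at x within {x..l})"
      by (rule has_vector_derivative_transform [rotated 2]) (use x xl Z in auto)
    then show ?thesis
      using at_within_Icc_neq_bot [OF xl] xl vector_derivative_unique_within [OF _ _ has_vector_derivative_const]
      by (metis atLeastAtMost_iff less_imp_le order_refl)
  qed
  have 1: "Kvec w x $ 1 = 0" if "x \<in> {-l..l}" for x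
    using continuous_on_zero_off_negligible [OF cont ll N(1) _ that] N(2) by (simp add: Kop_eq_Kvec [OF w])
  have 2: "Kvec w x $ 2 = 0" if "x \<in> {-l..l}" for x
    using continuous_on_zero_off_negligible [OF cont ll N' _ that] step [of 1, OF 1] by simp
  have 3: "Kvec w x $ 3 = 0" if "x \<in> {-l..l}" for x
    using continuous_on_zero_off_negligible [OF cont ll N' _ that] step [of 2, OF 2] by simp
  have 4: "Kvec w x $ 4 = 0" if "x \<in> {-l..l}" for x
    using continuous_on_zero_off_negligible [OF cont ll N' _ that] step [of 3, OF 3] by simp
  have "w x = 0" if "x \<in> {-l..l} - N'" for x
    using step [of 4, OF 4 that] 1 that \<alpha> k by simp
  then show ?thesis
    using N' by (auto simp: AE_lebesgue_on_iff)
qed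

lemma eigenvalue_imp_det:
  assumes lam: "lam \<in> Spec l (Kop l \<alpha> k M)"
  shows "lam \<noteq> 0" "det (boundary_matrix l \<alpha> k M lam) = 0"
proof -
  from lam obtain w where "w \<in> L2 l" and nz: "\<not> (AE x in lebesgue_on {-l..l}. w x = 0)"
    and ev: "AE x in lebesgue_on {-l..l}. Kop l \<alpha> k M w x = lam * w x"
    by (auto simp: Spec_def)
  then have w: "integrable (lebesgue_on {-l..l}) w"
    by (intro L2_integrable)
  show lam0: "lam \<noteq> 0"
    using Kop_injective [OF w] ev nz by auto
  obtain N where N: "negligible N" "\<And>x. x \<in> {-l..l} - N \<Longrightarrow> Kop l \<alpha> k M w x = lam * w x"
    using ev by (auto simp: AE_lebesgue_on_iff)
  \<comment> \<open>The continuous representative of \<open>w\<close>. It has the same moments, so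
    \<open>Kvec w\<close> is differentiable at every point and not only almost everywhere.\<close>
  define v where "v = (\<lambda>x. Kvec w x $ 1 / lam)"
  have vw: "v x = w x" if "x \<in> {-l..l} - N" for x
    using N(2) [OF that] that lam0 by (simp add: v_def Kop_eq_Kvec [OF w])
  have mom: "moments v x = moments w x" if "x \<le> l" for x
    using moments_cong_negligible [OF N(1) vw that] .
  have v: "continuous_on {-l..l} v"
    unfolding v_def by (intro continuous_on_divide Kvec_continuous_on continuous_on_const w) (simp add: lam0)
  have "solves (mu \<alpha> k lam) {-l..l} (Kvec w)"
    unfolding solves_def
  proof (intro ballI allI)
    fix x p assume x: "x \<in> {-l..l}"
    have "((\<lambda>t. Kvec w t $ p) has_vector_derivative companion (- of_real (\<alpha> ^ 4)) (Kvec w x) $ p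
      + (if p = 4 then of_real (\<alpha> ^ 4 / k) * v x else 0)) (at x within {-l..l})"
    proof (rule Kvec_has_vector_derivative)
      show "((\<lambda>t. moments w t $ j) has_vector_derivative yvec \<alpha> x $ j * v x) (at x within {-l..l})" for j
        by (rule has_vector_derivative_transform [OF x _ moments_has_vector_derivative [OF v x]])
          (simp add: mom)
    qed
    moreover have "companion (- of_real (\<alpha> ^ 4)) (Kvec w x) $ p
      + (if p = 4 then of_real (\<alpha> ^ 4 / k) * v x else 0) = companion (mu \<alpha> k lam) (Kvec w x) $ p"
      using lam0 k by (simp add: companion_def mu_def v_def field_simps)
    ultimately show "((\<lambda>t. Kvec w t $ p) has_vector_derivative companion (mu \<alpha> k lam) (Kvec w x) $ p)
        (at x within {-l..l})"
      by simp
  qed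
  moreover obtain R where F: "fundamental (mu \<alpha> k lam) (Wlam \<alpha> k lam) R"
    using fundamental_Wlam [OF lam0 k \<alpha>] .
  ultimately obtain c where c: "\<And>x. x \<in> {-l..l} \<Longrightarrow> Kvec w x = Wlam \<alpha> k lam x *v c"
    using fundamental_solution [OF F convex_real_interval(5)] by blast
  have "boundary_matrix l \<alpha> k M lam *v c = 0"
    using Kvec_boundary [of w] l
    by (simp add: c boundary_matrix_def matrix_vector_mult_add_rdistrib matrix_vector_mul_assoc)
  moreover have "c \<noteq> 0"
  proof
    assume "c = 0"
    then have "w x = 0" if "x \<in> {-l..l} - N" for x
      using vw [OF that] that c [of x] by (simp add: v_def)
    with N(1) nz show False
      by (auto simp: AE_lebesgue_on_iff)
  qed
  ultimately show "det (boundary_matrix l \<alpha> k M lam) = 0"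
    by (auto simp: det_eq_0_iff_kernel)
qed

text \<open>The candidate is the solution \<open>v\<close> given by a kernel vector.
  \<open>Kop v\<close> and \<open>lam v\<close> solve the same inhomogeneous boundary value problem,
  and invertibility of \<open>Mtilde\<close> makes them equal.\<close>

lemma det_imp_eigenvalue:
  assumes lam0: "lam \<noteq> 0" and det: "det (boundary_matrix l \<alpha> k M lam) = 0"
  shows "lam \<in> Spec l (Kop l \<alpha> k M)"
proof -
  have ll: "-l < l" using l by simp
  from det obtain c where c: "c \<noteq> 0" "boundary_matrix l \<alpha> k M lam *v c = 0"
    by (auto simp: det_eq_0_iff_kernel)
  obtain R where F: "fundamental (mu \<alpha> k lam) (Wlam \<alpha> k lam) R"
    using fundamental_Wlam [OF lam0 k \<alpha>] .
  note F' = fundamental_W [OF \<alpha>]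
  define V where "V = (\<lambda>x. Wlam \<alpha> k lam x *v c)"
  define v where "v = (\<lambda>x. V x $ 1)"
  have V: "solves (mu \<alpha> k lam) {-l..l} V"
    unfolding V_def by (rule fundamental_solves [OF F])
  then have v: "continuous_on {-l..l} v"
    unfolding v_def by (rule solves_continuous_on)
  have vL2: "v \<in> L2 l" by (rule continuous_in_L2 [OF v])
  note v_int = L2_integrable [OF vL2]
  have nz: "\<not> (AE x in lebesgue_on {-l..l}. v x = 0)"
  proof
    assume "AE x in lebesgue_on {-l..l}. v x = 0"
    then obtain N where "negligible N" "\<And>x. x \<in> {-l..l} - N \<Longrightarrow> v x = 0"
      by (auto simp: AE_lebesgue_on_iff)
    then have "v x = 0" if "x \<in> {-l..l}" for x
      using continuous_on_zero_off_negligible [OF v ll _ _ that] by blast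
    then have "c = 0"
      using fundamental_eq_0 [OF F ll] by (simp add: v_def V_def)
    with c(1) show False by simp
  qed
  \<comment> \<open>The source terms cancel in this difference, so it solves the homogeneous
    equation and has the form \<open>W d\<close>.\<close>
  define Z where "Z = (\<lambda>x. Kvec v x - lam *s V x)"
  have "solves (- of_real (\<alpha> ^ 4)) {-l..l} Z"
    unfolding solves_def
  proof (intro ballI allI)
    fix x p assume x: "x \<in> {-l..l}"
    have "((\<lambda>t. Kvec v t $ p - lam * V t $ p) has_vector_derivative
        (companion (- of_real (\<alpha> ^ 4)) (Kvec v x) $ p + (if p = 4 then of_real (\<alpha> ^ 4 / k) * v x else 0))
          - lam * companion (mu \<alpha> k lam) (V x) $ p) (at x within {-l..l})"
      by (intro has_vector_derivative_diff has_vector_derivative_mult_right solvesD [OF V x]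
          Kvec_has_vector_derivative moments_has_vector_derivative [OF v x])
    moreover have "(companion (- of_real (\<alpha> ^ 4)) (Kvec v x) $ p + (if p = 4 then of_real (\<alpha> ^ 4 / k) * v x else 0))
          - lam * companion (mu \<alpha> k lam) (V x) $ p = companion (- of_real (\<alpha> ^ 4)) (Z x) $ p"
      using lam0 k by (simp add: companion_def mu_def v_def Z_def field_simps)
    ultimately show "((\<lambda>t. Z t $ p) has_vector_derivative companion (- of_real (\<alpha> ^ 4)) (Z x) $ p)
        (at x within {-l..l})"
      by (simp add: Z_def)
  qed
  then obtain d where d: "\<And>x. x \<in> {-l..l} \<Longrightarrow> Z x = W \<alpha> x *v d"
    using fundamental_solution [OF F' convex_real_interval(5)] by blast
  have "Mtilde l \<alpha> M *v d = Mminus M *v Z (-l) + Mplus M *v Z l"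
    using l by (simp add: Mtilde_mult_vec d)
  also have "\<dots> = (Mminus M *v Kvec v (-l) + Mplus M *v Kvec v l)
      - lam *s (boundary_matrix l \<alpha> k M lam *v c)"
    by (simp add: Z_def V_def boundary_matrix_def matrix_vector_mult_diff_distrib vector_scalar_commute
        matrix_vector_mult_add_rdistrib matrix_vector_mul_assoc vec.scale_right_distrib)
  also have "\<dots> = 0"
    by (simp add: Kvec_boundary c)
  finally have "d = 0"
    using M by (metis det_eq_0_iff_kernel invertible_det_nz)
  then have "Kvec v x = lam *s V x" if "x \<in> {-l..l}" for x
    using d [OF that] by (simp add: Z_def)
  then have "Kop l \<alpha> k M v x = lam * v x" if "x \<in> {-l..l}" for x
    unfolding Kop_eq_Kvec [OF v_int that] using that by (simp add: v_def)
  then have "AE x in lebesgue_on {-l..l}. Kop l \<alpha> k M v x = lam * v x"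
    by (intro AE_I2) simp
  with vL2 nz show ?thesis
    by (auto simp: Spec_def)
qed

lemma Spec_Kop_iff:
  "lam \<in> Spec l (Kop l \<alpha> k M) \<longleftrightarrow> lam \<noteq> 0 \<and> det (boundary_matrix l \<alpha> k M lam) = 0"
  using eigenvalue_imp_det det_imp_eigenvalue by blast

end

theorem corollary1:
  fixes l \<alpha> k :: real and M :: "complex ^ 8 ^ 4" and lam :: complex
  assumes "l > 0" and "\<alpha> > 0" and "k > 0"
    and "M \<in> wp l \<alpha>"
  shows "(lam \<in> Spec l (Kop l \<alpha> k M) \<longleftrightarrow>
            lam \<noteq> 0 \<and> det (Gmat l \<alpha> M ** (X \<alpha> k lam l - X \<alpha> k lam (-l)) + X \<alpha> k lam l) = 0)
       \<and> (lam \<in> Spec l (Kop l \<alpha> k (Q \<alpha>)) \<longleftrightarrow>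
            lam \<noteq> 0 \<and> det (X \<alpha> k lam l) = 0)"
proof -
  have M: "invertible (Mtilde l \<alpha> M)"
    using assms by (intro wp_invertible_Mtilde)
  interpret M: Green_kernel l \<alpha> k M
    using assms M by unfold_locales
  interpret Q: Green_kernel l \<alpha> k "Q \<alpha>"
    using assms Mtilde_Q by unfold_locales
  show ?thesis
    unfolding M.Spec_Kop_iff Q.Spec_Kop_iff
    using det_boundary_matrix_eq_0_iff [OF assms(2) M] det_boundary_matrix_Q_eq_0_iff [OF assms(2)]
    by simp
qed

end
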